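(* There is an algorithm which takes as input an $n$-vertex graph $G=(V,E)$ together with a linear order $\prec$ of $V$, runs in time $2^{\mathcal{O}(\tau^3)}\cdot n$ where $\tau$ is the vertex cover number of $G$, and computes a page assignment $\sigma$ such that $\langle\prec,\sigma\rangle$ is a $\mathrm{fobt}(G,\prec)$-page book embedding of $G$.
   Context: $[k]=\{1,\dots,k\}$. A $k$-page book embedding of a graph $G=(V,E)$ is a pair $\langle \prec,\sigma\rangle$ where $\prec$ is a linear order of $V$ and $\sigma\colon E\to[k]$, such that there are no two edges $uv,wx\in E$ with $\sigma(uv)=\sigma(wx)$ and $u\prec w\prec v\prec x$. The fixed-order book thickness $\mathrm{fobt}(G,\prec)$ is the minimum $k$ such that there exists $\sigma\colon E\to[k]$ with $\langle\prec,\sigma\rangle$ a $k$-page book embedding of $G$. The vertex cover number $\tau(G)$ is the minimum size of a set $C\subseteq V$ such that every edge has an endpoint in $C$. *)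

theory Defs
  imports Complex_Main "HOL-Library.Landau_Symbols" "HOL-Library.FuncSet"
begin

section \<open>Graphs, vertex covers, book embeddings\<close>

definition fin_graph :: "'a set \<Rightarrow> 'a set set \<Rightarrow> bool" where
  "fin_graph V E \<longleftrightarrow> finite V \<and> (\<forall>e\<in>E. e \<subseteq> V \<and> card e = 2)"

definition vertex_cover :: "'a set \<Rightarrow> 'a set set \<Rightarrow> 'a set \<Rightarrow> bool" where
  "vertex_cover V E C \<longleftrightarrow> C \<subseteq> V \<and> (\<forall>e\<in>E. \<exists>v\<in>e. v \<in> C)"

definition vertex_cover_number :: "'a set \<Rightarrow> 'a set set \<Rightarrow> nat" where
  "vertex_cover_number V E = (LEAST k. \<exists>C. vertex_cover V E C \<and> card C = k)"

definition vertex_order :: "'a set \<Rightarrow> 'a rel \<Rightarrow> bool" where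
  "vertex_order V r \<longleftrightarrow> r \<subseteq> V \<times> V \<and> strict_linear_order_on V r"

definition book_embedding ::
    "nat \<Rightarrow> 'a set \<Rightarrow> 'a set set \<Rightarrow> 'a rel \<Rightarrow> ('a set \<Rightarrow> nat) \<Rightarrow> bool" where
  "book_embedding k V E r \<sigma> \<longleftrightarrow>
     vertex_order V r \<and> \<sigma> \<in> E \<rightarrow> {1..k} \<and>
     \<not> (\<exists>u v w x. {u, v} \<in> E \<and> {w, x} \<in> E \<and> \<sigma> {u, v} = \<sigma> {w, x} \<and>
                  (u, w) \<in> r \<and> (w, v) \<in> r \<and> (v, x) \<in> r)"

definition fobt :: "'a set \<Rightarrow> 'a set set \<Rightarrow> 'a rel \<Rightarrow> nat" where
  "fobt V E r = (LEAST k. \<exists>\<sigma>. book_embedding k V E r \<sigma>)"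

lemma vertex_cover_number_attained:
  assumes "fin_graph V E"
  shows "\<exists>C. vertex_cover V E C \<and> card C = vertex_cover_number V E"
proof -
  have "\<exists>v\<in>e. v \<in> V" if "e \<in> E" for e
  proof -
    have "e \<subseteq> V" "card e = 2" using assms that by (auto simp: fin_graph_def)
    then show ?thesis by (metis card.empty ex_in_conv subsetD zero_neq_numeral)
  qed
  then have "vertex_cover V E V" by (simp add: vertex_cover_def)
  then have "\<exists>k C. vertex_cover V E C \<and> card C = k" by blast
  then show ?thesis unfolding vertex_cover_number_def by (rule LeastI_ex)
qed

lemma fobt_attained:
  assumes "fin_graph V E" and r: "vertex_order V r"
  shows "\<exists>\<sigma>. book_embedding (fobt V E r) V E r \<sigma>"
proof -
  have "finite E"
    using assms(1) by (auto simp: fin_graph_def intro: finite_subset[of E "Pow V"])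
  then obtain \<sigma> where \<sigma>: "bij_betw \<sigma> E {1..card E}"
    using finite_same_card_bij[of E "{1..card E}"] by auto
  have ir: "irrefl r"
    using r by (auto simp: vertex_order_def strict_linear_order_on_def)
  have "False" if "{u, v} \<in> E" "{w, x} \<in> E" "\<sigma> {u, v} = \<sigma> {w, x}"
    "(u, w) \<in> r" "(w, v) \<in> r" "(v, x) \<in> r" for u v w x
  proof -
    have "{u, v} = {w, x}" using \<sigma> that(1-3) by (auto simp: bij_betw_def dest: inj_onD)
    then have "w = u \<or> w = v" by auto
    then show False using that(4,5) ir by (auto simp: irrefl_def)
  qed
  then have "book_embedding (card E) V E r \<sigma>"
    using r \<sigma> unfolding book_embedding_def by (auto simp: bij_betw_def)
  then have "\<exists>k \<sigma>. book_embedding k V E r \<sigma>" by blast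
  then show ?thesis unfolding fobt_def by (rule LeastI_ex)
qed

section \<open>Random access machine\<close>

text \<open>
  The uniform-cost random access machine with addition and truncated subtraction
  as its only arithmetic, presented as a structured language.  Registers are named
  by numerals fixed in the program; the memory is addressed only indirectly,
  through the contents of registers.
\<close>

datatype prog =
    Skip
  | Imm nat nat
  | Move nat nat
  | Add nat nat nat
  | Sub nat nat nat
  | Load nat nat
  | Store nat nat
  | Seq prog prog
  | Cond nat prog prog
  | While nat prog

type_synonym state = "(nat \<Rightarrow> nat) \<times> (nat \<Rightarrow> nat)"

text \<open>
  \<open>exec p s t s'\<close>: started in \<open>s = (R, M)\<close> (registers, memory), \<open>p\<close> terminates in
  \<open>s'\<close> after exactly \<open>t\<close> steps.  Every elementary instruction and every test takes one step.
\<close>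

inductive exec :: "prog \<Rightarrow> state \<Rightarrow> nat \<Rightarrow> state \<Rightarrow> bool" where
  Skip: "exec Skip s 1 s"
| Imm: "exec (Imm d k) (R, M) 1 (R(d := k), M)"
| Move: "exec (Move d a) (R, M) 1 (R(d := R a), M)"
| Add: "exec (Add d a b) (R, M) 1 (R(d := R a + R b), M)"
| Sub: "exec (Sub d a b) (R, M) 1 (R(d := R a - R b), M)"
| Load: "exec (Load d a) (R, M) 1 (R(d := M (R a)), M)"
| Store: "exec (Store a b) (R, M) 1 (R, M(R a := R b))"
| Seq: "exec p s t s' \<Longrightarrow> exec q s' t' s'' \<Longrightarrow> exec (Seq p q) s (t + t') s''"
| Cond_nonzero: "fst s a \<noteq> 0 \<Longrightarrow> exec p s t s' \<Longrightarrow> exec (Cond a p q) s (1 + t) s'"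
| Cond_zero: "fst s a = 0 \<Longrightarrow> exec q s t s' \<Longrightarrow> exec (Cond a p q) s (1 + t) s'"
| While_zero: "fst s a = 0 \<Longrightarrow> exec (While a p) s 1 s"
| While_nonzero: "fst s a \<noteq> 0 \<Longrightarrow> exec p s t s' \<Longrightarrow> exec (While a p) s' t' s'' \<Longrightarrow>
    exec (While a p) s (1 + t + t') s''"

inductive_cases exec_SkipE: "exec Skip s t s'"
inductive_cases exec_ImmE: "exec (Imm d k) s t s'"
inductive_cases exec_MoveE: "exec (Move d a) s t s'"
inductive_cases exec_AddE: "exec (Add d a b) s t s'"
inductive_cases exec_SubE: "exec (Sub d a b) s t s'"
inductive_cases exec_LoadE: "exec (Load d a) s t s'"
inductive_cases exec_StoreE: "exec (Store a b) s t s'"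
inductive_cases exec_SeqE: "exec (Seq p q) s t s'"
inductive_cases exec_CondE: "exec (Cond a p q) s t s'"
inductive_cases exec_WhileE: "exec (While a p) s t s'"

lemma exec_deterministic:
  "exec p s t s' \<Longrightarrow> exec p s u s'' \<Longrightarrow> t = u \<and> s' = s''"
proof (induction arbitrary: u s'' rule: exec.induct)
  case Skip then show ?case by (rule exec_SkipE) simp
next
  case Imm then show ?case by (rule exec_ImmE) simp
next
  case Move then show ?case by (rule exec_MoveE) simp
next
  case Add then show ?case by (rule exec_AddE) simp
next
  case Sub then show ?case by (rule exec_SubE) simp
next
  case Load then show ?case by (rule exec_LoadE) simp
next
  case Store then show ?case by (rule exec_StoreE) simp
next
  case Seq from Seq.prems show ?case by (rule exec_SeqE) (metis Seq.IH)
next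
  case Cond_nonzero
  from Cond_nonzero.prems show ?case
    by (rule exec_CondE) (use Cond_nonzero.IH Cond_nonzero.hyps(1) in fastforce)+
next
  case Cond_zero
  from Cond_zero.prems show ?case
    by (rule exec_CondE) (use Cond_zero.IH Cond_zero.hyps(1) in fastforce)+
next
  case While_zero
  from While_zero.prems show ?case
    by (rule exec_WhileE) (use While_zero.hyps(1) in simp_all)
next
  case (While_nonzero s a p t s1 t' s2)
  from While_nonzero.prems show ?case
  proof (rule exec_WhileE)
    fix v s3 v'
    assume "u = Suc (v + v')" and "exec p s v s3" and w: "exec (While a p) s3 v' s''"
    moreover from this have "t = v" "s1 = s3" using While_nonzero.IH(1) by blast+
    moreover from this w have "t' = v'" "s2 = s''" using While_nonzero.IH(2) by blast+
    ultimately show ?thesis by simp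
  qed (use While_nonzero.hyps(1) in simp)
qed

section \<open>Input and output\<close>

fun edge_of :: "'a \<times> 'a \<Rightarrow> 'a set" where
  "edge_of (u, v) = {u, v}"

text \<open>
  An instance is presented by its vertices in increasing order and by its edges,
  each listed exactly once, in any order and with either orientation.
\<close>

definition presents ::
    "'a list \<Rightarrow> ('a \<times> 'a) list \<Rightarrow> 'a set \<Rightarrow> 'a set set \<Rightarrow> 'a rel \<Rightarrow> bool" where
  "presents vs es V E r \<longleftrightarrow>
     set vs = V \<and> distinct vs \<and> sorted_wrt (\<lambda>u v. (u, v) \<in> r) vs \<and>
     edge_of ` set es = E \<and> distinct (map edge_of es)"

text \<open>
  Registers 0 and 1 hold the numbers of vertices and edges; the memory holds the vertex
  list followed by the two endpoints of each listed edge; everything else is 0.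
\<close>

definition init_state :: "nat list \<Rightarrow> (nat \<times> nat) list \<Rightarrow> state" where
  "init_state vs es =
     (let xs = vs @ concat (map (\<lambda>(u, v). [u, v]) es)
      in ((\<lambda>_. 0)(0 := length vs, 1 := length es),
          (\<lambda>i. if i < length xs then xs ! i else 0)))"

text \<open>The page of the \<open>j\<close>-th listed edge is found in memory cell \<open>j\<close>.\<close>

definition outputs :: "state \<Rightarrow> (nat \<times> nat) list \<Rightarrow> (nat set \<Rightarrow> nat) \<Rightarrow> bool" where
  "outputs s es \<sigma> \<longleftrightarrow> (\<forall>j < length es. snd s j = \<sigma> (edge_of (es ! j)))"

end

theory Submission
  imports Defs
begin

text \<open>
  Greedily matched edges give a vertex cover with \<open>c \<le> 2\<tau>\<close> vertices.  They cut the order into gaps, and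
  an edge, directed towards the cover, is of one of \<open>(2c + 1)c\<close> types: the gap or cover vertex of its
  source together with its target.  If edges are processed by the position of their sources, whether a
  new edge crosses an earlier one depends only on the type of the earlier one.  So the set of pairs
  (page, type) used so far, one of \<open>2 ^ ((2c + 1)c\<^sup>2)\<close> states since \<open>c\<close> pages always suffice, is all that a
  dynamic program has to remember; it computes for every item and state the least number of the last
  page needed for the remaining items, and an optimal assignment is read off in a forward pass.
\<close>

section \<open>Total correctness with running times\<close>

text \<open>Let an edge have source \<open>s\<close> and target \<open>t\<close>, and a later one
  source \<open>s'\<close> and target \<open>t'\<close>. Whether they cross is decided by comparing
  these four positions. Targets are cover vertices, so the gap of \<open>s\<close> settles its
  comparisons with \<open>t\<close> and \<open>t'\<close>, and the processing order settles the one
  with \<open>s'\<close>. An earlier edge may therefore be replaced by the first edge of its type,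
  and only the two ends of that edge are stored per type. Common sources are the one exception and
  dictate the order of their targets.

  The cubic exponent is the number \<open>W * c\<close> of (page, type) pairs, with \<open>c\<close>
  at most twice the vertex cover number. The factor \<open>n\<close> needs a bound on the number of
  edges and a sort without logarithm: keys are injective with values below \<open>2 * c * n\<close>,
  which yields both. The machine has neither multiplication nor bit operations; products are carried
  along as running sums, and sets are unpacked by trial subtraction of powers of two. This costs
  factors polynomial in \<open>c\<close>, which the exponential absorbs.\<close>

definition wp :: "prog \<Rightarrow> (nat \<Rightarrow> (nat \<Rightarrow> nat) \<Rightarrow> (nat \<Rightarrow> nat) \<Rightarrow> bool) \<Rightarrow> (nat \<Rightarrow> nat) \<Rightarrow> (nat \<Rightarrow> nat) \<Rightarrow> bool" where
  "wp p Q R M \<longleftrightarrow> (\<exists>t R' M'. exec p (R, M) t (R', M') \<and> Q t R' M')"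

lemma wp_Skip [simp]: "wp Skip Q R M = Q 1 R M"
  unfolding wp_def by (metis exec.Skip exec_SkipE prod.inject)

lemma wp_Imm [simp]: "wp (Imm d k) Q R M = Q 1 (R(d := k)) M"
  unfolding wp_def by (metis exec.Imm exec_ImmE prod.inject)

lemma wp_Move [simp]: "wp (Move d a) Q R M = Q 1 (R(d := R a)) M"
  unfolding wp_def by (metis exec.Move exec_MoveE prod.inject)

lemma wp_Add [simp]: "wp (Add d a b) Q R M = Q 1 (R(d := R a + R b)) M"
  unfolding wp_def by (metis exec.Add exec_AddE prod.inject)

lemma wp_Sub [simp]: "wp (Sub d a b) Q R M = Q 1 (R(d := R a - R b)) M"
  unfolding wp_def by (metis exec.Sub exec_SubE prod.inject)

lemma wp_Load [simp]: "wp (Load d a) Q R M = Q 1 (R(d := M (R a))) M"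
  unfolding wp_def by (metis exec.Load exec_LoadE prod.inject)

lemma wp_Store [simp]: "wp (Store a b) Q R M = Q 1 R (M(R a := R b))"
  unfolding wp_def by (metis exec.Store exec_StoreE prod.inject)

lemma wp_Seq [simp]: "wp (Seq p q) Q R M = wp p (\<lambda>t. wp q (\<lambda>t'. Q (t + t'))) R M"
  unfolding wp_def
proof safe
  fix t R' M' assume "exec (Seq p q) (R, M) t (R', M')" "Q t R' M'"
  then show "\<exists>t R' M'. exec p (R, M) t (R', M') \<and>
      (\<exists>t' R'' M''. exec q (R', M') t' (R'', M'') \<and> Q (t + t') R'' M'')"
    by (auto elim!: exec_SeqE) blast
next
  fix t R' M' t' R'' M''
  assume "exec p (R, M) t (R', M')" "exec q (R', M') t' (R'', M'')" "Q (t + t') R'' M''"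
  then show "\<exists>t R' M'. exec (Seq p q) (R, M) t (R', M') \<and> Q t R' M'"
    using exec.Seq by blast
qed

lemma wp_Cond [simp]:
  "wp (Cond a p q) Q R M = (if R a \<noteq> 0 then wp p (\<lambda>t. Q (1 + t)) R M else wp q (\<lambda>t. Q (1 + t)) R M)"
proof -
  have "exec (Cond a p q) (R, M) t s' \<longleftrightarrow>
      (\<exists>u. t = 1 + u \<and> exec (if R a \<noteq> 0 then p else q) (R, M) u s')" for t s'
    by (auto elim!: exec_CondE intro: exec.Cond_nonzero[unfolded plus_1_eq_Suc]
        exec.Cond_zero[unfolded plus_1_eq_Suc])
  then show ?thesis unfolding wp_def by auto
qed

lemma wp_While_zero: "R a = 0 \<Longrightarrow> Q 1 R M \<Longrightarrow> wp (While a p) Q R M"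
  unfolding wp_def by (metis exec.While_zero fst_conv)

lemma wp_While_nonzero:
  "R a \<noteq> 0 \<Longrightarrow> wp p (\<lambda>t. wp (While a p) (\<lambda>t'. Q (1 + t + t'))) R M \<Longrightarrow> wp (While a p) Q R M"
  unfolding wp_def by (metis exec.While_nonzero fst_conv)

lemma wp_mono: "wp p Q R M \<Longrightarrow> (\<And>t R' M'. Q t R' M' \<Longrightarrow> Q' t R' M') \<Longrightarrow> wp p Q' R M"
  unfolding wp_def by blast

primrec writes :: "prog \<Rightarrow> nat set" where
  "writes Skip = {}"
| "writes (Imm d k) = {d}"
| "writes (Move d a) = {d}"
| "writes (Add d a b) = {d}"
| "writes (Sub d a b) = {d}"
| "writes (Load d a) = {d}"
| "writes (Store a b) = {}"
| "writes (Seq p q) = writes p \<union> writes q"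
| "writes (Cond a p q) = writes p \<union> writes q"
| "writes (While a p) = writes p"

lemma exec_frame: "exec p s t s' \<Longrightarrow> r \<notin> writes p \<Longrightarrow> fst s' r = fst s r"
  by (induction rule: exec.induct) auto

text \<open>Specifications need not list the registers that survive: everything outside
  \<open>writes p\<close> is supplied here. Memory has no such rule, so each specification states
  which cells it leaves alone.\<close>

lemma wp_use:
  assumes "wp p Q R M"
    and "\<And>t R' M'. Q t R' M' \<Longrightarrow> (\<And>r. r \<notin> writes p \<Longrightarrow> R' r = R r) \<Longrightarrow> Q' t R' M'"
  shows "wp p Q' R M"
  using assms exec_frame[of p "(R, M)"] unfolding wp_def by (metis fst_conv)

notation Seq (infixr ";;" 60)

lemma wp_SeqI:
  assumes "wp p Q R M"
    and "\<And>t R' M'. Q t R' M' \<Longrightarrow> (\<And>r. r \<notin> writes p \<Longrightarrow> R' r = R r) \<Longrightarrow> wp q (\<lambda>t'. Q' (t + t')) R' M'"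
  shows "wp (p ;; q) Q' R M"
  unfolding wp_Seq using assms by (rule wp_use)

section \<open>Counting loops and multiplication\<close>

definition For :: "nat \<Rightarrow> nat \<Rightarrow> nat \<Rightarrow> prog \<Rightarrow> prog" where
  "For i d l body = Seq (Imm i 0) (Seq (Sub d l i)
     (While d (Seq body (Seq (Imm d 1) (Seq (Add i i d) (Sub d l i))))))"

lemma writes_For [simp]: "writes (For i d l body) = {i, d} \<union> writes body"
  by (auto simp: For_def)

text \<open>The bound counts two initialisations and the final test, then per round one test, the
  body and three bookkeeping instructions. Those overwrite \<open>i\<close> and \<open>d\<close>
  between rounds, so \<open>Inv\<close> must not depend on them; the value of \<open>i\<close> is
  handed to \<open>step\<close> separately.\<close>

lemma wp_For:
  assumes ne: "i \<noteq> d" "l \<noteq> i" "l \<noteq> d" and body: "i \<notin> writes body" "l \<notin> writes body"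
    and N: "R l = N"
    and init: "Inv 0 R M"
    and insens: "\<And>k R M x y. Inv k R M \<Longrightarrow> Inv k (R(i := x, d := y)) M"
    and step: "\<And>k R' M'. \<lbrakk>k < N; R' i = k; Inv k R' M';
        \<And>r. r \<notin> {i, d} \<union> writes body \<Longrightarrow> R' r = R r\<rbrakk> \<Longrightarrow>
        wp body (\<lambda>t R'' M''. t \<le> T \<and> Inv (Suc k) R'' M'') R' M'"
  shows "wp (For i d l body) (\<lambda>t R' M'. t \<le> 3 + N * (T + 4) \<and> Inv N R' M') R M"
proof -
  let ?W = "While d (Seq body (Seq (Imm d 1) (Seq (Add i i d) (Sub d l i))))"
  \<comment> \<open>Induction on the number \<open>j\<close> of rounds left, which is exactly what
    register \<open>d\<close> holds.\<close>
  have loop: "wp ?W (\<lambda>t R' M'. t \<le> 1 + j * (T + 4) \<and> Inv N R' M') R' M'"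
    if "j \<le> N" "R' i = N - j" "R' d = j" "Inv (N - j) R' M'"
      "\<And>r. r \<notin> {i, d} \<union> writes body \<Longrightarrow> R' r = R r" for j R' M'
    using that
  proof (induction j arbitrary: R' M')
    case 0
    then show ?case by (intro wp_While_zero) auto
  next
    case (Suc j)
    have lN: "R' l = N" using Suc.prems(5)[of l] ne body N by auto
    have b: "wp body (\<lambda>t R'' M''. t \<le> T \<and> Inv (Suc (N - Suc j)) R'' M'') R' M'"
      using Suc.prems by (intro step) auto
    have "wp body (\<lambda>t. wp (Seq (Imm d 1) (Seq (Add i i d) (Sub d l i)))
       (\<lambda>t'. wp ?W (\<lambda>t'' R'' M''. 1 + (t + t') + t'' \<le> 1 + Suc j * (T + 4) \<and> Inv N R'' M''))) R' M'"
    proof (rule wp_use[OF b])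
      fix t R'' M''
      assume a: "t \<le> T \<and> Inv (Suc (N - Suc j)) R'' M''"
        and fr: "\<And>r. r \<notin> writes body \<Longrightarrow> R'' r = R' r"
      have i'': "R'' i = N - Suc j" "R'' l = N" using fr body Suc.prems(2) lN by auto
      have eq: "Suc (N - Suc j) = N - j" using Suc.prems(1) by simp
      let ?R = "R''(i := N - j, d := j)"
      have upd: "R''(d := Suc 0, i := Suc (N - Suc j), d := N - Suc (N - Suc j)) = ?R"
        using Suc.prems(1) eq ne by auto
      have inv: "Inv (N - j) ?R M''" using a eq insens by metis
      have "wp ?W (\<lambda>t' R'' M''. t' \<le> 1 + j * (T + 4) \<and> Inv N R'' M'') ?R M''"
      proof (rule Suc.IH[OF _ _ _ inv])
        show "?R r = R r" if "r \<notin> {i, d} \<union> writes body" for r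
          using that fr Suc.prems(5) by auto
      qed (use ne Suc.prems(1) in simp_all)
      then have "wp ?W (\<lambda>t' R'' M''. 1 + (t + 3) + t' \<le> 1 + Suc j * (T + 4) \<and> Inv N R'' M'') ?R M''"
        by (rule wp_mono) (use a in auto)
      then show "wp (Seq (Imm d 1) (Seq (Add i i d) (Sub d l i)))
         (\<lambda>t'. wp ?W (\<lambda>t'' R'' M''. 1 + (t + t') + t'' \<le> 1 + Suc j * (T + 4) \<and> Inv N R'' M'')) R'' M''"
        using ne i'' by (simp add: upd numeral_3_eq_3)
    qed
    then show ?case
      using Suc.prems(3) by (intro wp_While_nonzero) (simp_all add: add.assoc)
  qed
  have "wp ?W (\<lambda>t R' M'. t \<le> 1 + N * (T + 4) \<and> Inv N R' M') (R(i := 0, d := N)) M"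
    using ne N insens[OF init] by (intro loop) auto
  then show ?thesis
    unfolding For_def using ne N by (auto elim!: wp_mono simp: fun_upd_same)
qed

definition Mul :: "nat \<Rightarrow> nat \<Rightarrow> nat \<Rightarrow> nat \<Rightarrow> nat \<Rightarrow> prog" where
  "Mul d a b i l = Seq (Imm d 0) (For i l b (Add d d a))"

lemma writes_Mul [simp]: "writes (Mul d a b i l) = {d, i, l}"
  by (auto simp: Mul_def)

text \<open>Repeated addition, with time linear in the second factor; it is affordable only outside
  of loops.\<close>

lemma wp_Mul:
  assumes "distinct [d, a, i, l]" "distinct [d, b, i, l]"
  shows "wp (Mul d a b i l) (\<lambda>t R' M'. t \<le> 4 + R b * 5 \<and> R' d = R a * R b \<and> M' = M) R M"
proof -
  have "wp (For i l b (Add d d a)) (\<lambda>t R' M'. t \<le> 3 + R b * (1 + 4) \<and> R' d = R a * R b \<and> M' = M)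
     (R(d := 0)) M"
    by (rule wp_For[where Inv = "\<lambda>k R' M'. R' d = R a * k \<and> M' = M"]) (use assms in auto)
  then show ?thesis
    unfolding Mul_def by (auto elim!: wp_mono)
qed

section \<open>Dynamic program over page-type sets\<close>

lemma pair_eq:
  fixes a b a' b' k :: nat
  assumes "a * k + b = a' * k + b'" "b < k" "b' < k"
  shows "a = a' \<and> b = b'"
proof -
  have "a = (a * k + b) div k" "a' = (a' * k + b') div k" "b = (a * k + b) mod k" "b' = (a' * k + b') mod k"
    using assms(2,3) by auto
  then show ?thesis using assms(1) by metis
qed

definition crosses :: "nat \<Rightarrow> nat \<Rightarrow> nat \<Rightarrow> nat \<Rightarrow> bool" where
  "crosses a b x y \<longleftrightarrow> a < x \<and> x < b \<and> b < y \<or> x < a \<and> a < y \<and> y < b"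

lemma crosses_sym: "crosses a b x y \<longleftrightarrow> crosses x y a b"
  by (auto simp: crosses_def)

text \<open>Item \<open>t\<close> has ends \<open>X t\<close>, \<open>Y t\<close> and type
  \<open>T t\<close>, while \<open>LO y\<close>, \<open>HI y\<close> are the ends of an edge
  standing in for type \<open>y\<close>. The recursion is meaningful for any such ends; that they
  give the right answers is added in \<open>page_dp_rep\<close>.\<close>

locale page_dp =
  fixes c W m :: nat and X Y T LO HI :: "nat \<Rightarrow> nat"
  assumes T_less: "t < m \<Longrightarrow> T t < W"
begin

text \<open>A state is the number whose bit \<open>p * W + y\<close> says that page
  \<open>p\<close>, counted from 0, already holds an item of type \<open>y\<close>. As a number it
  serves directly as an offset into a table row.\<close>

definition page_ok :: "nat \<Rightarrow> nat \<Rightarrow> nat \<Rightarrow> bool" where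
  "page_ok s t p \<longleftrightarrow> (\<forall>y<W. bit s (p * W + y) \<longrightarrow> \<not> crosses (LO y) (HI y) (X t) (Y t))"

definition next_state :: "nat \<Rightarrow> nat \<Rightarrow> nat \<Rightarrow> nat" where
  "next_state s t p = set_bit (p * W + T t) s"

text \<open>
  The value is (cost, page, successor state), pages being numbered from 1; cost \<open>Suc c\<close> means that no
  page is possible.
\<close>

primrec choose_page :: "(nat \<Rightarrow> nat) \<Rightarrow> nat \<Rightarrow> nat \<Rightarrow> nat \<Rightarrow> nat \<times> nat \<times> nat" where
  "choose_page v s t 0 = (Suc c, 0, 0)"
| "choose_page v s t (Suc p) =
     (if page_ok s t p \<and> max (Suc p) (v (next_state s t p)) < fst (choose_page v s t p)
      then (max (Suc p) (v (next_state s t p)), Suc p, next_state s t p)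
      else choose_page v s t p)"

text \<open>Indexed by the number \<open>j\<close> of items still to be placed, which makes the
  recursion structural; the item treated is then \<open>m - Suc j\<close>.\<close>

primrec cost :: "nat \<Rightarrow> nat \<Rightarrow> nat" where
  "cost 0 s = 0"
| "cost (Suc j) s = fst (choose_page (cost j) s (m - Suc j) c)"

lemma choose_page_attained:
  assumes "fst (choose_page v s t k) \<le> c"
  obtains p where "p < k" "page_ok s t p"
    "choose_page v s t k = (max (Suc p) (v (next_state s t p)), Suc p, next_state s t p)"
  using assms
proof (induction k arbitrary: thesis)
  case (Suc k)
  show ?case
  proof (cases "page_ok s t k \<and> max (Suc k) (v (next_state s t k)) < fst (choose_page v s t k)")
    case True
    then show ?thesis by (intro Suc.prems(1)[of k]) auto
  next
    case False
    then have eq: "choose_page v s t (Suc k) = choose_page v s t k" by auto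
    then obtain p where "p < k" "page_ok s t p"
      "choose_page v s t k = (max (Suc p) (v (next_state s t p)), Suc p, next_state s t p)"
      using Suc by metis
    then show ?thesis using eq by (intro Suc.prems(1)[of p]) auto
  qed
qed simp

lemma choose_page_le:
  assumes "p < k" "page_ok s t p"
  shows "fst (choose_page v s t k) \<le> max (Suc p) (v (next_state s t p))"
  using assms
proof (induction k)
  case (Suc k)
  show ?case
  proof (cases "p = k")
    case True
    then show ?thesis using Suc.prems by (cases "max (Suc p) (v (next_state s t p)) < fst (choose_page v s t p)") auto
  next
    case False
    then have "fst (choose_page v s t k) \<le> max (Suc p) (v (next_state s t p))" using Suc by simp
    then show ?thesis by auto
  qed
qed simp

primrec enc :: "(nat \<Rightarrow> nat) \<Rightarrow> nat \<Rightarrow> nat" where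
  "enc f 0 = 0"
| "enc f (Suc t) = next_state (enc f t) t (f t)"

lemma bit_enc: "bit (enc f t) b \<longleftrightarrow> (\<exists>a<t. b = f a * W + T a)"
  by (induction t) (auto simp: next_state_def bit_set_bit_iff less_Suc_eq)

lemma next_state_less:
  assumes "s < 2 ^ (W * c)" "t < m" "p < c"
  shows "next_state s t p < 2 ^ (W * c)"
proof -
  have "p * W + T t < Suc p * W" using T_less[OF assms(2)] by simp
  also have "\<dots> \<le> W * c" using assms(3) by (metis Suc_leI mult.commute mult_le_mono2)
  finally have "p * W + T t < W * c" .
  moreover have "n < W * c" if "bit s n" for n
    using that assms(1) by (metis bit_take_bit_iff take_bit_nat_eq_self)
  ultimately have "take_bit (W * c) (next_state s t p) = next_state s t p"
    by (intro bit_eqI) (auto simp: next_state_def bit_simps)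
  then show ?thesis by (simp add: take_bit_nat_eq_self_iff)
qed

lemma enc_less: "\<lbrakk>\<And>a. a < t \<Longrightarrow> f a < c; t \<le> m\<rbrakk> \<Longrightarrow> enc f t < 2 ^ (W * c)"
  by (induction t) (auto intro: next_state_less)

text \<open>Types are below \<open>W\<close>, so a bit index determines its page and type and the
  set loses nothing but multiplicities.\<close>

lemma page_ok_enc:
  assumes "t < m"
  shows "page_ok (enc f t) t p \<longleftrightarrow> (\<forall>a<t. f a = p \<longrightarrow> \<not> crosses (LO (T a)) (HI (T a)) (X t) (Y t))"
proof -
  have "(\<exists>a<t. p * W + y = f a * W + T a) \<longleftrightarrow> (\<exists>a<t. p = f a \<and> y = T a)" if "y < W" for y
    using pair_eq[OF _ that T_less] assms by auto
  moreover have "T a < W" if "a < t" for a using T_less assms that by simp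
  ultimately show ?thesis unfolding page_ok_def bit_enc by blast
qed

end

text \<open>The representative has to answer only for pairs with \<open>a < t\<close>. This
  asymmetry is what the processing order is designed for.\<close>

locale page_dp_rep = page_dp +
  assumes rep: "\<lbrakk>a < t; t < m\<rbrakk> \<Longrightarrow>
    crosses (LO (T a)) (HI (T a)) (X t) (Y t) \<longleftrightarrow> crosses (X a) (Y a) (X t) (Y t)"
begin

definition noncrossing :: "(nat \<Rightarrow> nat) \<Rightarrow> bool" where
  "noncrossing f \<longleftrightarrow> (\<forall>t<m. \<forall>a<t. f a = f t \<longrightarrow> \<not> crosses (X a) (Y a) (X t) (Y t))"

text \<open>Along \<open>f\<close> its own page is always a candidate of the minimum, because
  \<open>K \<le> c\<close>; hence, going backwards from the last item, no cost exceeds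
  \<open>K\<close>. This is the optimality half of the dynamic program.\<close>

lemma cost_le:
  assumes f: "noncrossing f" "\<And>t. t < m \<Longrightarrow> f t < K" and K: "K \<le> c" "j \<le> m"
  shows "cost j (enc f (m - j)) \<le> K"
  using K(2)
proof (induction j)
  case (Suc j)
  let ?t = "m - Suc j"
  have t: "?t < m" "m - j = Suc ?t" using Suc.prems by auto
  have "page_ok (enc f ?t) ?t (f ?t)"
    using page_ok_enc[OF t(1)] rep t(1) f(1) by (auto simp: noncrossing_def)
  moreover have "f ?t < c" using f(2)[OF t(1)] K by simp
  ultimately have "cost (Suc j) (enc f ?t) \<le> max (Suc (f ?t)) (cost j (enc f (Suc ?t)))"
    using choose_page_le[of "f ?t" c "enc f ?t" ?t "cost j"] by simp
  also have "\<dots> \<le> K" using Suc f(2)[OF t(1)] t(2) by simp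
  finally show ?case .
qed simp

text \<open>The state met before item \<open>t\<close> in the forward pass. Each choice is made with
  the exact cost of the remaining items, so following it is optimal.\<close>

primrec greedy :: "nat \<Rightarrow> nat" where
  "greedy 0 = 0"
| "greedy (Suc t) = snd (snd (choose_page (cost (m - Suc t)) (greedy t) t c))"

definition page_of :: "nat \<Rightarrow> nat" where
  "page_of t = fst (snd (choose_page (cost (m - Suc t)) (greedy t) t c))"

text \<open>The chosen maximum bounds both the page taken and the cost of the successor state, so
  neither ever exceeds the initial optimum. Pages count from 1 in \<open>page_of\<close> and from 0
  inside states, hence the \<open>- 1\<close>.\<close>

lemma greedy_step:
  assumes "cost m 0 \<le> c" "t \<le> m"
  shows "greedy t = enc (\<lambda>a. page_of a - 1) t \<and> cost (m - t) (greedy t) \<le> cost m 0 \<and>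
    (\<forall>a<t. page_ok (enc (\<lambda>a. page_of a - 1) a) a (page_of a - 1) \<and> 1 \<le> page_of a \<and> page_of a \<le> cost m 0)"
  using assms(2)
proof (induction t)
  case (Suc t)
  let ?r = "choose_page (cost (m - Suc t)) (greedy t) t c"
  have mt: "m - t = Suc (m - Suc t)" "m - Suc (m - Suc t) = t" using Suc.prems by auto
  have IH: "greedy t = enc (\<lambda>a. page_of a - 1) t" "cost (m - t) (greedy t) \<le> cost m 0" using Suc by auto
  have c: "cost (m - t) (greedy t) = fst ?r" using mt by simp
  then have "fst ?r \<le> c" using IH(2) assms(1) by simp
  then obtain p where p: "p < c" "page_ok (greedy t) t p"
    "?r = (max (Suc p) (cost (m - Suc t) (next_state (greedy t) t p)), Suc p, next_state (greedy t) t p)"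
    by (rule choose_page_attained)
  have pg: "page_of t = Suc p" using p(3) by (simp add: page_of_def)
  have g: "greedy (Suc t) = next_state (greedy t) t p" using p(3) by simp
  have "max (Suc p) (cost (m - Suc t) (next_state (greedy t) t p)) \<le> cost m 0"
    using p(3) c IH(2) by simp
  moreover have "\<forall>a<t. page_ok (enc (\<lambda>a. page_of a - 1) a) a (page_of a - 1) \<and>
      1 \<le> page_of a \<and> page_of a \<le> cost m 0"
    using Suc by simp
  ultimately show ?case
    unfolding g enc.simps using IH(1)[symmetric] pg p(2) by (simp add: less_Suc_eq all_conj_distrib)
qed simp

lemma page_of_noncrossing:
  assumes "cost m 0 \<le> c"
  shows "noncrossing page_of" "t < m \<Longrightarrow> page_of t \<in> {1..cost m 0}"
proof -
  note st = greedy_step[OF assms order_refl]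
  show "t < m \<Longrightarrow> page_of t \<in> {1..cost m 0}" using st by auto
  show "noncrossing page_of"
    unfolding noncrossing_def
  proof (intro allI impI)
    fix t a assume *: "t < m" "a < t" "page_of a = page_of t"
    then show "\<not> crosses (X a) (Y a) (X t) (Y t)"
      using st page_ok_enc[OF *(1), of "\<lambda>a. page_of a - 1" "page_of t - 1"] rep by auto
  qed
qed

text \<open>Keeps the lookups of the forward pass inside a table row.\<close>

lemma greedy_less:
  assumes "cost m 0 \<le> c" "t \<le> m"
  shows "greedy t < 2 ^ (W * c)"
proof -
  have "page_of a - 1 < c" if "a < t" for a
    using page_of_noncrossing(2)[OF assms(1), of a] that assms by auto
  then show ?thesis using greedy_step[OF assms] enc_less[of t "\<lambda>a. page_of a - 1"] assms(2) by auto
qed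

end

section \<open>Cover, types and processing order\<close>

lemma pair_less:
  fixes a b a' b' k :: nat
  assumes "k * a + b < k * a' + b'" "b < k" "b' < k"
  shows "a < a' \<or> a = a' \<and> b < b'"
proof -
  have "a \<le> a'"
  proof (rule ccontr)
    assume "\<not> a \<le> a'"
    then have "k * Suc a' \<le> k * a" by (intro mult_le_mono2) simp
    then show False using assms by simp
  qed
  then show ?thesis using assms by auto
qed

locale ordered_graph =
  fixes vs :: "nat list" and es :: "(nat \<times> nat) list" and n m :: nat
  assumes n_def: "n = length vs" and m_def: "m = length es"
    and set_vs: "set vs = {..<n}" and distinct_vs: "distinct vs"
    and es_in: "j < m \<Longrightarrow> fst (es ! j) < n \<and> snd (es ! j) < n \<and> fst (es ! j) \<noteq> snd (es ! j)"
    and distinct_es: "distinct (map edge_of es)"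
begin

section \<open>A vertex cover from greedily matched edges\<close>

primrec marked :: "nat \<Rightarrow> nat set" where
  "marked 0 = {}"
| "marked (Suc j) = (if fst (es ! j) \<in> marked j \<or> snd (es ! j) \<in> marked j then marked j
     else {fst (es ! j), snd (es ! j)} \<union> marked j)"

definition cov :: "nat set" where "cov = marked m"

definition c :: nat where "c = card cov"

lemma marked_subset: "j \<le> m \<Longrightarrow> marked j \<subseteq> {..<n}"
  using es_in by (induction j) auto

lemma finite_marked [simp]: "finite (marked j)"
  by (induction j) auto

lemma marked_mono: "i \<le> j \<Longrightarrow> marked i \<subseteq> marked j"
  by (rule lift_Suc_mono_le[of marked]) auto

lemma cov_covers: "e < m \<Longrightarrow> fst (es ! e) \<in> cov \<or> snd (es ! e) \<in> cov"
  using marked_mono[of "Suc e" m] unfolding cov_def by (auto split: if_splits)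

lemma cov_subset: "cov \<subseteq> {..<n}"
  unfolding cov_def using marked_subset by simp

lemma card_marked_Suc:
  "j < m \<Longrightarrow> \<not> (fst (es ! j) \<in> marked j \<or> snd (es ! j) \<in> marked j) \<Longrightarrow>
    card (marked (Suc j)) = Suc (Suc (card (marked j)))"
  using es_in[of j] by simp

text \<open>Each matched edge adds two vertices, and at least one of them is a new member of the
  cover \<open>K\<close>.\<close>

lemma card_marked_le:
  assumes "finite K" "\<And>e. e < m \<Longrightarrow> fst (es ! e) \<in> K \<or> snd (es ! e) \<in> K" "j \<le> m"
  shows "card (marked j) \<le> 2 * card (marked j \<inter> K)"
  using assms(3)
proof (induction j)
  case (Suc j)
  show ?case
  proof (cases "fst (es ! j) \<in> marked j \<or> snd (es ! j) \<in> marked j")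
    case False
    have "card (marked j \<inter> K) < card (marked (Suc j) \<inter> K)"
      using assms(1) assms(2)[of j] Suc.prems False by (intro psubset_card_mono) auto
    then show ?thesis using Suc card_marked_Suc[OF _ False] by simp
  qed (use Suc in auto)
qed simp

lemma c_le:
  assumes "finite K" "\<And>e. e < m \<Longrightarrow> fst (es ! e) \<in> K \<or> snd (es ! e) \<in> K"
  shows "c \<le> 2 * card K"
proof -
  have "c \<le> 2 * card (cov \<inter> K)" unfolding c_def cov_def using card_marked_le[OF assms] by simp
  also have "\<dots> \<le> 2 * card K" using assms(1) by (simp add: card_mono)
  finally show ?thesis .
qed

section \<open>Positions, gaps and classes\<close>

definition pos :: "nat \<Rightarrow> nat" where "pos v = (THE i. i < n \<and> vs ! i = v)"

lemma pos_nth [simp]: "i < n \<Longrightarrow> pos (vs ! i) = i"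
  unfolding pos_def using distinct_vs n_def by (intro the_equality) (auto simp: nth_eq_iff_index_eq)

lemma pos: "v < n \<Longrightarrow> pos v < n" "v < n \<Longrightarrow> vs ! pos v = v"
proof -
  have "\<exists>i<n. vs ! i = v" if "v < n" using that set_vs n_def by (metis in_set_conv_nth lessThan_iff)
  then show "v < n \<Longrightarrow> pos v < n" "v < n \<Longrightarrow> vs ! pos v = v" using pos_nth by metis+
qed

lemma pos_inject: "u < n \<Longrightarrow> v < n \<Longrightarrow> pos u = pos v \<longleftrightarrow> u = v"
  using pos by metis

definition cntp :: "nat \<Rightarrow> nat" where "cntp i = card {k. k < i \<and> vs ! k \<in> cov}"

text \<open>On cover vertices this is the rank, injective and below \<open>c\<close>; on all others
  it is the number of the gap, from 0 to \<open>c\<close>.\<close>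

definition cnt :: "nat \<Rightarrow> nat" where "cnt v = cntp (pos v)"

text \<open>Odd classes are the single cover vertices, even classes the gaps between them.\<close>

definition cls :: "nat \<Rightarrow> nat" where "cls v = 2 * cnt v + of_bool (v \<in> cov)"

lemma cntp_0 [simp]: "cntp 0 = 0"
  by (simp add: cntp_def)

lemma cntp_Suc: "cntp (Suc i) = cntp i + of_bool (vs ! i \<in> cov)"
proof -
  have "{k. k < Suc i \<and> vs ! k \<in> cov} =
      (if vs ! i \<in> cov then insert i {k. k < i \<and> vs ! k \<in> cov} else {k. k < i \<and> vs ! k \<in> cov})"
    by (auto simp: less_Suc_eq)
  then show ?thesis by (simp add: cntp_def)
qed

lemma cntp_mono: "i \<le> j \<Longrightarrow> cntp i \<le> cntp j"
  by (rule lift_Suc_mono_le[of cntp]) (auto simp: cntp_Suc)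

lemma cntp_n: "cntp n = c"
proof -
  have "bij_betw ((!) vs) {k. k < n \<and> vs ! k \<in> cov} cov"
    using distinct_vs cov_subset set_vs n_def
    by (auto simp: bij_betw_def inj_on_def nth_eq_iff_index_eq image_iff)
      (metis in_set_conv_nth subsetD)
  then show ?thesis unfolding cntp_def c_def by (rule bij_betw_same_card)
qed

lemma cnt_mono: "pos u \<le> pos v \<Longrightarrow> cnt u \<le> cnt v"
  unfolding cnt_def by (rule cntp_mono)

lemma cnt_strict: "u \<in> cov \<Longrightarrow> pos u < pos v \<Longrightarrow> cnt u < cnt v"
proof -
  assume a: "u \<in> cov" "pos u < pos v"
  then have "u < n" using cov_subset by auto
  then have "cntp (Suc (pos u)) = Suc (cnt u)" using a(1) pos by (simp add: cntp_Suc cnt_def)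
  moreover have "cntp (Suc (pos u)) \<le> cnt v" unfolding cnt_def using a(2) by (intro cntp_mono) simp
  ultimately show ?thesis by simp
qed

lemma cnt_le: "v < n \<Longrightarrow> cnt v \<le> c"
  unfolding cnt_def cntp_n[symmetric] using pos(1)[of v] by (intro cntp_mono) simp

lemma cnt_less: "v \<in> cov \<Longrightarrow> cnt v < c"
proof -
  assume a: "v \<in> cov"
  then have v: "v < n" using cov_subset by auto
  have "Suc (cnt v) = cntp (Suc (pos v))" using pos(2)[OF v] a by (simp add: cntp_Suc cnt_def)
  also have "\<dots> \<le> c" unfolding cntp_n[symmetric] using pos(1)[OF v] by (intro cntp_mono) simp
  finally show ?thesis by simp
qed

lemma cnt_inject: "u \<in> cov \<Longrightarrow> v \<in> cov \<Longrightarrow> cnt u = cnt v \<Longrightarrow> u = v"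
  using cnt_strict pos_inject cov_subset by (metis lessThan_iff less_irrefl linorder_neqE_nat subsetD)

lemma cls_le: "v < n \<Longrightarrow> cls v \<le> 2 * c"
  using cnt_le[of v] cnt_less[of v] by (auto simp: cls_def)

text \<open>Parity of the class separates cover vertices from gaps. Rank identifies a cover vertex,
  and a cover vertex lying between two others would make their counts differ.\<close>

lemma same_cls:
  assumes "cls u = cls v" "u < n" "v < n"
  shows "u = v \<or> u \<notin> cov \<and> v \<notin> cov \<and> (\<forall>w\<in>cov. (pos w < pos u \<longleftrightarrow> pos w < pos v) \<and> pos w \<noteq> pos u \<and> pos w \<noteq> pos v)"
proof (cases "u \<in> cov \<or> v \<in> cov")
  case True
  have "odd (cls w) \<longleftrightarrow> w \<in> cov" for w by (simp add: cls_def)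
  then have cv: "u \<in> cov" "v \<in> cov" using True assms(1) by metis+
  then have "cnt u = cnt v" using assms(1) by (simp add: cls_def)
  then show ?thesis using cnt_inject cv by auto
next
  case False
  then have eq: "cnt u = cnt v" using assms(1) by (simp add: cls_def)
  have "(pos w < pos u \<longleftrightarrow> pos w < pos v) \<and> pos w \<noteq> pos u \<and> pos w \<noteq> pos v" if w: "w \<in> cov" for w
  proof -
    have "w < n" using w cov_subset by auto
    then have "pos w \<noteq> pos u" "pos w \<noteq> pos v" using w False pos_inject assms by metis+
    then show ?thesis
      using cnt_strict[OF w, of u] cnt_strict[OF w, of v] cnt_mono[of u w] cnt_mono[of v w] eq
      by (metis leI less_irrefl less_le_trans)
  qed
  then show ?thesis using False by auto
qed

section \<open>Directed edges, their types and the processing order\<close>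

text \<open>If both ends are in the cover the direction is arbitrary; it is fixed by the second
  listed end, the only one whose mark \<open>edges_body\<close> inspects.\<close>

definition tgt :: "nat \<Rightarrow> nat" where
  "tgt e = (if snd (es ! e) \<in> cov then snd (es ! e) else fst (es ! e))"

definition src :: "nat \<Rightarrow> nat" where
  "src e = (if snd (es ! e) \<in> cov then fst (es ! e) else snd (es ! e))"

text \<open>Two digits in base \<open>c\<close>: the class is at most \<open>2 * c\<close> and the
  rank is below \<open>c\<close>, which explains \<open>W\<close>.\<close>

definition ty :: "nat \<Rightarrow> nat" where "ty e = cls (src e) * c + cnt (tgt e)"

definition W :: nat where "W = (2 * c + 1) * c"

text \<open>
  The order of the edges with a common source matters because the first edge of a type, which stands in
  for all of them, may start further left in the same gap.  Taking the targets left of the source first,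
  and on each side the rightmost target first, it crosses none of the later edges of that source.
\<close>

definition key :: "nat \<Rightarrow> nat" where
  "key e = 2 * c * pos (src e) + ((c - 1 - cnt (tgt e)) + (if pos (src e) < pos (tgt e) then c else 0))"

definition lft :: "nat \<Rightarrow> nat" where "lft e = min (pos (src e)) (pos (tgt e))"

definition rgt :: "nat \<Rightarrow> nat" where "rgt e = max (pos (src e)) (pos (tgt e))"

lemma src_tgt:
  assumes "e < m"
  shows "src e < n" "tgt e < n" "tgt e \<in> cov" "src e \<noteq> tgt e" "pos (src e) \<noteq> pos (tgt e)"
    "edge_of (es ! e) = {src e, tgt e}"
proof -
  show *: "src e < n" "tgt e < n" "tgt e \<in> cov" "src e \<noteq> tgt e"
    using es_in[OF assms] cov_covers[OF assms] by (auto simp: src_def tgt_def)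
  then show "pos (src e) \<noteq> pos (tgt e)" using pos_inject by auto
  show "edge_of (es ! e) = {src e, tgt e}" by (cases "es ! e") (auto simp: src_def tgt_def)
qed

lemma ty_less: "e < m \<Longrightarrow> ty e < W"
proof -
  assume e: "e < m"
  have "ty e < Suc (cls (src e)) * c" using cnt_less[OF src_tgt(3)[OF e]] by (simp add: ty_def)
  also have "\<dots> \<le> W" unfolding W_def using cls_le[OF src_tgt(1)[OF e]] by (intro mult_le_mono1) simp
  finally show ?thesis .
qed

abbreviation offset :: "nat \<Rightarrow> nat" where
  "offset e \<equiv> (c - 1 - cnt (tgt e)) + (if pos (src e) < pos (tgt e) then c else 0)"

lemma offset_less: "e < m \<Longrightarrow> offset e < 2 * c"
  using cnt_less[OF src_tgt(3)[of e]] by auto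

lemma key_less: "e < m \<Longrightarrow> key e < 2 * c * n"
proof -
  assume e: "e < m"
  have "key e < 2 * c * Suc (pos (src e))" using offset_less[OF e] by (simp add: key_def)
  also have "\<dots> \<le> 2 * c * n" using pos(1)[OF src_tgt(1)[OF e]] by (intro mult_le_mono2) simp
  finally show ?thesis .
qed

text \<open>The key reveals source and target, and the graph has no parallel edges. So a bucket per
  key receives at most one edge.\<close>

lemma key_inject: "e < m \<Longrightarrow> e' < m \<Longrightarrow> key e = key e' \<longleftrightarrow> e = e'"
proof
  assume e: "e < m" "e' < m" "key e = key e'"
  have "pos (src e) = pos (src e') \<and> offset e = offset e'"
    using e(3) offset_less[OF e(1)] offset_less[OF e(2)] unfolding key_def
    by (intro pair_eq[of _ "2 * c"]) (simp_all add: mult.commute)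
  then have s: "src e = src e'" and o: "offset e = offset e'"
    using pos_inject src_tgt(1) e(1,2) by auto
  \<comment> \<open>As ranks are below \<open>c\<close>, the subtraction in the offset is not
    truncated and its value is below \<open>c\<close>; so the summand \<open>c\<close> and the rank
    can be told apart.\<close>
  have "cnt (tgt e) = cnt (tgt e')"
    using o cnt_less[OF src_tgt(3)[OF e(1)]] cnt_less[OF src_tgt(3)[OF e(2)]]
    by (auto split: if_splits)
  then have "tgt e = tgt e'" using cnt_inject src_tgt(3) e by blast
  then have "edge_of (es ! e) = edge_of (es ! e')" using s src_tgt(6) e by simp
  then show "e = e'" using distinct_es e m_def by (auto simp: distinct_conv_nth)
qed simp

text \<open>Keys compare lexicographically as position and offset, and smaller offsets mean left
  targets before right ones and, on each side, larger ranks first.\<close>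

lemma key_less_cases:
  assumes "key e < key e'" "e < m" "e' < m"
  shows "pos (src e) < pos (src e') \<or> src e = src e' \<and>
    (pos (src e) < pos (tgt e) \<longrightarrow> pos (src e) < pos (tgt e') \<and> pos (tgt e') < pos (tgt e)) \<and>
    (pos (tgt e) < pos (src e) \<longrightarrow> pos (src e) < pos (tgt e') \<or> pos (tgt e') < pos (tgt e))"
proof -
  have "pos (src e) < pos (src e') \<or> pos (src e) = pos (src e') \<and> offset e < offset e'"
    using assms(1) offset_less[OF assms(2)] offset_less[OF assms(3)] unfolding key_def
    by (rule pair_less)
  then show ?thesis
  proof
    assume a: "pos (src e) = pos (src e') \<and> offset e < offset e'"
    then have s: "src e = src e'" using pos_inject src_tgt(1) assms by auto
    note c = cnt_less[OF src_tgt(3)[OF assms(2)]] cnt_less[OF src_tgt(3)[OF assms(3)]]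
    have "pos (tgt e') < pos (tgt e)" if "cnt (tgt e') < cnt (tgt e)"
      using that cnt_mono[of "tgt e" "tgt e'"] by (meson not_le)
    moreover have "pos (src e) < pos (tgt e) \<Longrightarrow> pos (src e) < pos (tgt e') \<and> cnt (tgt e') < cnt (tgt e)"
      using a c by (auto split: if_splits)
    moreover have "pos (tgt e) < pos (src e) \<Longrightarrow> pos (src e) < pos (tgt e') \<or> cnt (tgt e') < cnt (tgt e)"
      using a c by (auto split: if_splits)
    ultimately show ?thesis using s by blast
  qed simp
qed

text \<open>Both edges share their target, and distinct sources lie in one gap with that of
  \<open>e0\<close> further left. No target separates the two sources, and a source of
  \<open>e'\<close> right of \<open>src e\<close> is also right of \<open>src e0\<close>, so all
  comparisons agree. If \<open>src e' = src e\<close>, then \<open>e\<close> and \<open>e'\<close>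
  share an end and do not cross; by the order of the targets \<open>e0\<close> is then nested with
  \<open>e'\<close> or disjoint from it.\<close>

lemma crosses_first_of_type:
  assumes ty: "ty e0 = ty e" and key: "key e0 \<le> key e" "key e < key e'" and m: "e0 < m" "e < m" "e' < m"
  shows "crosses (lft e0) (rgt e0) (lft e') (rgt e') \<longleftrightarrow> crosses (lft e) (rgt e) (lft e') (rgt e')"
proof -
  note lt = cnt_less[OF src_tgt(3)[OF m(1)]] cnt_less[OF src_tgt(3)[OF m(2)]]
  have "cls (src e0) = cls (src e) \<and> cnt (tgt e0) = cnt (tgt e)"
    using ty lt unfolding ty_def by (rule pair_eq)
  then have cl: "cls (src e0) = cls (src e)" and t: "tgt e0 = tgt e"
    using cnt_inject src_tgt(3) m by auto
  show ?thesis
  proof (cases "src e0 = src e")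
    case True
    then show ?thesis using t by (simp add: lft_def rgt_def)
  next
    case False
    have g: "src e0 \<notin> cov" "src e \<notin> cov" "\<And>w. w \<in> cov \<Longrightarrow> (pos w < pos (src e0) \<longleftrightarrow> pos w < pos (src e))
       \<and> pos w \<noteq> pos (src e0) \<and> pos w \<noteq> pos (src e)"
      using same_cls[OF cl] src_tgt(1) m False by auto
    have ne: "key e0 \<noteq> key e" using key_inject m False by auto
    then have le: "pos (src e0) < pos (src e)"
      using key_less_cases[of e0 e] key m False by auto
    have "pos (src e) < pos (src e') \<or> src e = src e' \<and>
     (pos (src e) < pos (tgt e) \<longrightarrow> pos (src e) < pos (tgt e') \<and> pos (tgt e') < pos (tgt e)) \<and>
     (pos (tgt e) < pos (src e) \<longrightarrow> pos (src e) < pos (tgt e') \<or> pos (tgt e') < pos (tgt e))"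
      using key_less_cases[OF key(2)] m by blast
    then show ?thesis
      using le g(3)[OF src_tgt(3)[OF m(2)]] g(3)[OF src_tgt(3)[OF m(3)]] src_tgt(5)[OF m(2)] src_tgt(5)[OF m(3)]
      unfolding crosses_def lft_def rgt_def t min_def max_def
      by (smt (verit) leD le_less_linear less_trans not_less_iff_gr_or_eq)
  qed
qed

section \<open>Bucket sort by key\<close>

text \<open>Follows the machine's scan over the buckets, so that the loop invariant can name the
  list produced so far.\<close>

primrec sorted_edges :: "nat \<Rightarrow> nat list" where
  "sorted_edges 0 = []"
| "sorted_edges (Suc t) = sorted_edges t @ (if \<exists>e<m. key e = t then [THE e. e < m \<and> key e = t] else [])"

lemma the_key: "e < m \<Longrightarrow> (THE e'. e' < m \<and> key e' = key e) = e"
  using key_inject by (intro the_equality) auto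

lemma set_sorted_edges: "set (sorted_edges t) = {e. e < m \<and> key e < t}"
proof (induction t)
  case (Suc t)
  show ?case
  proof (cases "\<exists>e<m. key e = t")
    case True
    then obtain e where "e < m" "key e = t" by auto
    then show ?thesis using Suc the_key[of e] key_inject[of _ e] by (auto simp: less_Suc_eq)
  next
    case False
    then show ?thesis using Suc by (auto simp: less_Suc_eq)
  qed
qed simp

lemma sorted_sorted_edges: "sorted_wrt (\<lambda>e e'. key e < key e') (sorted_edges t)"
proof (induction t)
  case (Suc t)
  then show ?case using the_key by (auto simp: sorted_wrt_append set_sorted_edges)
qed simp

lemma distinct_sorted_edges: "distinct (sorted_edges t)"
  using sorted_sorted_edges[of t] by (auto simp: distinct_conv_nth sorted_wrt_iff_nth_less)
    (metis linorder_neqE_nat less_irrefl)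

lemma length_sorted_edges: "length (sorted_edges t) = card {e. e < m \<and> key e < t}"
  using distinct_card[OF distinct_sorted_edges, of t] set_sorted_edges by simp

lemma length_sorted_edges_le: "length (sorted_edges t) \<le> m"
proof -
  have "card {e. e < m \<and> key e < t} \<le> card {..<m}" by (intro card_mono) auto
  then show ?thesis by (simp add: length_sorted_edges)
qed

definition item :: "nat \<Rightarrow> nat" where "item t = sorted_edges (2 * c * n) ! t"

lemma set_sorted_edges_all: "set (sorted_edges (2 * c * n)) = {..<m}"
  using key_less by (auto simp: set_sorted_edges)

lemma length_sorted_edges_all: "length (sorted_edges (2 * c * n)) = m"
  using distinct_card[OF distinct_sorted_edges, of "2 * c * n"] set_sorted_edges_all by simp

lemma item_less: "t < m \<Longrightarrow> item t < m"
  unfolding item_def using set_sorted_edges_all length_sorted_edges_all by (metis lessThan_iff nth_mem)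

lemma item_key: "s < t \<Longrightarrow> t < m \<Longrightarrow> key (item s) < key (item t)"
  unfolding item_def using sorted_sorted_edges length_sorted_edges_all by (simp add: sorted_wrt_iff_nth_less)

lemma bij_item: "bij_betw item {..<m} {..<m}"
proof -
  have "item = (!) (sorted_edges (2 * c * n))" by (simp add: item_def fun_eq_iff)
  moreover have "bij_betw ((!) (sorted_edges (2 * c * n))) {..<m} {..<m}"
    by (rule bij_betw_nth[OF distinct_sorted_edges]) (simp_all only: length_sorted_edges_all set_sorted_edges_all)
  ultimately show ?thesis by (simp only:)
qed

text \<open>\<open>rep f j\<close> records, for every type, the value of \<open>f\<close> at the first edge
  of that type among the last \<open>j\<close> items.\<close>

primrec rep :: "(nat \<Rightarrow> nat) \<Rightarrow> nat \<Rightarrow> nat \<Rightarrow> nat" where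
  "rep f 0 = (\<lambda>_. 0)"
| "rep f (Suc j) = (rep f j)(ty (item (m - Suc j)) := f (item (m - Suc j)))"

text \<open>The items are visited backwards, so the last write for a type is by its earliest item.
  The witness \<open>k\<close> is chosen before \<open>f\<close>, which ensures that the left and
  right ends stored for a type belong to one edge.\<close>

lemma rep_first:
  assumes "j \<le> m" "m - j \<le> t" "t < m"
  shows "\<exists>k. m - j \<le> k \<and> k \<le> t \<and> ty (item k) = ty (item t) \<and> (\<forall>f. rep f j (ty (item t)) = f (item k))"
  using assms
proof (induction j)
  case (Suc j)
  show ?case
  proof (cases "ty (item t) = ty (item (m - Suc j))")
    case True
    then show ?thesis using Suc.prems by (intro exI[of _ "m - Suc j"]) auto
  next
    case False
    then have "t \<noteq> m - Suc j" by auto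
    then have "m - j \<le> t" using Suc.prems by linarith
    then obtain k where "m - j \<le> k \<and> k \<le> t \<and> ty (item k) = ty (item t) \<and> (\<forall>f. rep f j (ty (item t)) = f (item k))"
      using Suc by auto
    then show ?thesis using False by (intro exI[of _ k]) auto
  qed
qed simp

text \<open>The first item \<open>k\<close> of the type of \<open>a\<close> satisfies
  \<open>k \<le> a < t\<close>, which is the situation of
  \<open>crosses_first_of_type\<close>.\<close>

sublocale dp: page_dp_rep c W m "\<lambda>t. lft (item t)" "\<lambda>t. rgt (item t)" "\<lambda>t. ty (item t)"
  "rep lft m" "rep rgt m"
proof
  fix t assume "t < m" then show "ty (item t) < W" by (intro ty_less item_less)
next
  fix a t assume a: "a < t" "t < m"
  then obtain k where k: "k \<le> a" "ty (item k) = ty (item a)" "\<And>f. rep f m (ty (item a)) = f (item k)"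
    using rep_first[of m a] by auto
  have "key (item k) \<le> key (item a)" using item_key[of k a] k(1) a by (cases "k = a") auto
  then show "crosses (rep lft m (ty (item a))) (rep rgt m (ty (item a))) (lft (item t)) (rgt (item t)) =
     crosses (lft (item a)) (rgt (item a)) (lft (item t)) (rgt (item t))"
    unfolding k(3) using a k(1) by (intro crosses_first_of_type k(2) item_key item_less) auto
qed

end

section \<open>Preprocessing on the machine\<close>

text \<open>
  After the preprocessing the registers below are constant; \<open>rMark\<close> to \<open>rVal\<close> hold the base addresses
  of arrays.  Registers 30 to 49 are scratch of the preprocessing.  In the dynamic program the current
  state, the left end, right end and type of the current item, and the address of the table row of the
  next item are in registers 50 to 54, and the chosen cost, page and successor state in 60 to 62.
\<close>

abbreviation (input) rN :: nat where "rN \<equiv> 0"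
abbreviation (input) rM :: nat where "rM \<equiv> 1"
abbreviation (input) rC :: nat where "rC \<equiv> 2"
abbreviation (input) rMark :: nat where "rMark \<equiv> 3"
abbreviation (input) rPos :: nat where "rPos \<equiv> 4"
abbreviation (input) rRow :: nat where "rRow \<equiv> 5"
abbreviation (input) rCls :: nat where "rCls \<equiv> 6"
abbreviation (input) rCnt :: nat where "rCnt \<equiv> 7"
abbreviation (input) rTy :: nat where "rTy \<equiv> 8"
abbreviation (input) rLft :: nat where "rLft \<equiv> 9"
abbreviation (input) rRgt :: nat where "rRgt \<equiv> 10"
abbreviation (input) rOrd :: nat where "rOrd \<equiv> 11"
abbreviation (input) rSlot :: nat where "rSlot \<equiv> 12"
abbreviation (input) rLo :: nat where "rLo \<equiv> 13"
abbreviation (input) rHi :: nat where "rHi \<equiv> 14"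
abbreviation (input) rBits :: nat where "rBits \<equiv> 15"
abbreviation (input) rPow :: nat where "rPow \<equiv> 16"
abbreviation (input) rVal :: nat where "rVal \<equiv> 17"
abbreviation (input) rW :: nat where "rW \<equiv> 18"
abbreviation (input) rD :: nat where "rD \<equiv> 19"
abbreviation (input) rB :: nat where "rB \<equiv> 20"
abbreviation (input) rS :: nat where "rS \<equiv> 21"
abbreviation (input) rC2 :: nat where "rC2 \<equiv> 22"

section \<open>Programs of the preprocessing\<close>

definition mark_body :: prog where
  "mark_body =
     Load 32 31 ;; Imm 36 1 ;; Add 31 31 36 ;; Load 33 31 ;; Add 31 31 36 ;;
     Add 34 rMark 32 ;; Add 35 rMark 33 ;; Load 37 34 ;; Load 38 35 ;; Add 37 37 38 ;;
     Cond 37 Skip (Store 34 36 ;; Store 35 36 ;; Add rC rC 36 ;; Add rC rC 36)"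

definition mark_prog :: prog where
  "mark_prog = Imm rC 0 ;; Move 31 rN ;; For 30 39 rM mark_body"

text \<open>Registers 31 and 33 carry the products \<open>2 * c * i\<close> and
  \<open>2 * cntp i * c\<close> as running sums. The row and class arrays thus hold their values
  already multiplied, in the form in which \<open>key\<close> and \<open>ty\<close> need
  them.\<close>

definition scan_body :: prog where
  "scan_body =
     Load 34 30 ;; Add 36 rMark 34 ;; Load 36 36 ;;
     Add 35 rPos 34 ;; Store 35 30 ;;
     Add 35 rRow 34 ;; Store 35 31 ;;
     Add 35 rCnt 34 ;; Store 35 32 ;;
     Add 35 rCls 34 ;;
     Cond 36 (Add 33 33 rC ;; Store 35 33 ;; Add 33 33 rC ;; Imm 37 1 ;; Add 32 32 37)
       (Store 35 33) ;;
     Add 31 31 rC2"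

definition scan_prog :: prog where
  "scan_prog = Imm 31 0 ;; Imm 32 0 ;; Imm 33 0 ;; For 30 39 rN scan_body"

text \<open>A slot receives the edge number plus one, so that the 0 of untouched memory means an
  empty bucket.\<close>

definition edges_body :: prog where
  "edges_body =
     Load 32 31 ;; Imm 40 1 ;; Add 31 31 40 ;; Load 33 31 ;; Add 31 31 40 ;;
     Add 34 rMark 33 ;; Load 34 34 ;;
     Cond 34 Skip (Move 35 32 ;; Move 32 33 ;; Move 33 35) ;;
     Add 36 rCnt 33 ;; Load 36 36 ;;
     Add 37 rCls 32 ;; Load 37 37 ;; Add 37 37 36 ;;
     Add 41 rPos 32 ;; Load 41 41 ;; Add 42 rPos 33 ;; Load 42 42 ;;
     Add 44 rRow 32 ;; Load 44 44 ;;
     Sub 43 rC 40 ;; Sub 43 43 36 ;; Add 43 43 44 ;; Add 43 43 rSlot ;;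
     Add 38 rTy 30 ;; Store 38 37 ;;
     Add 45 rLft 30 ;; Add 46 rRgt 30 ;; Add 48 30 40 ;; Sub 47 42 41 ;;
     Cond 47 (Store 45 41 ;; Store 46 42 ;; Add 43 43 rC) (Store 45 42 ;; Store 46 41) ;;
     Store 43 48"

definition edges_prog :: prog where
  "edges_prog = Move 31 rN ;; For 30 39 rM edges_body"

definition sort_body :: prog where
  "sort_body =
     Add 32 rSlot 30 ;; Load 32 32 ;;
     Cond 32 (Imm 33 1 ;; Sub 32 32 33 ;; Add 34 rOrd 31 ;; Store 34 32 ;; Add 31 31 33) Skip"

definition sort_prog :: prog where
  "sort_prog = Imm 31 0 ;; For 30 39 rS sort_body"

definition rep_body :: prog where
  "rep_body =
     Sub 31 rM 30 ;; Imm 32 1 ;; Sub 31 31 32 ;; Add 31 rOrd 31 ;; Load 31 31 ;;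
     Add 33 rTy 31 ;; Load 33 33 ;; Add 34 rLft 31 ;; Load 34 34 ;; Add 35 rRgt 31 ;; Load 35 35 ;;
     Add 36 rLo 33 ;; Store 36 34 ;; Add 37 rHi 33 ;; Store 37 35"

definition rep_prog :: prog where
  "rep_prog = For 30 39 rM rep_body"

definition pow_prog :: prog where
  "pow_prog = Imm rB 1 ;; For 30 39 rD (Add 31 rPow 30 ;; Store 31 rB ;; Add rB rB rB)"

context ordered_graph
begin

section \<open>Memory layout and contents of registers\<close>

text \<open>The number of (page, type) pairs, that is, of bits in a state.\<close>

definition D :: nat where "D = W * c"

definition aMark :: nat where "aMark = n + 2 * m"
definition aPos :: nat where "aPos = aMark + n"
definition aRow :: nat where "aRow = aPos + n"
definition aCls :: nat where "aCls = aRow + n"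
definition aCnt :: nat where "aCnt = aCls + n"
definition aTy :: nat where "aTy = aCnt + n"
definition aLft :: nat where "aLft = aTy + m"
definition aRgt :: nat where "aRgt = aLft + m"
definition aOrd :: nat where "aOrd = aRgt + m"
definition aSlot :: nat where "aSlot = aOrd + m"
definition aLo :: nat where "aLo = aSlot + 2 * c * n"
definition aHi :: nat where "aHi = aLo + W"
definition aBits :: nat where "aBits = aHi + W"
definition aPow :: nat where "aPow = aBits + D"
definition aVal :: nat where "aVal = aPow + D"

lemmas addr_defs = aPos_def aRow_def aCls_def aCnt_def aTy_def aLft_def aRgt_def aOrd_def
  aSlot_def aLo_def aHi_def aBits_def aPow_def aVal_def

text \<open>The addresses that do not involve \<open>c\<close>; they are available before the
  marking has determined \<open>c\<close>, the remaining ones of \<open>regs1\<close> only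
  afterwards.\<close>

definition regs0 :: "(nat \<Rightarrow> nat) \<Rightarrow> bool" where
  "regs0 R \<longleftrightarrow> R rN = n \<and> R rM = m \<and> R rMark = aMark \<and> R rPos = aPos \<and> R rRow = aRow \<and>
     R rCls = aCls \<and> R rCnt = aCnt \<and> R rTy = aTy \<and> R rLft = aLft \<and> R rRgt = aRgt \<and>
     R rOrd = aOrd \<and> R rSlot = aSlot"

definition regs1 :: "(nat \<Rightarrow> nat) \<Rightarrow> bool" where
  "regs1 R \<longleftrightarrow> regs0 R \<and> R rC = c \<and> R rLo = aLo \<and> R rHi = aHi \<and> R rBits = aBits \<and>
     R rPow = aPow \<and> R rVal = aVal \<and> R rW = W \<and> R rD = D \<and> R rS = 2 * c * n \<and> R rC2 = 2 * c"

definition input_mem :: "(nat \<Rightarrow> nat) \<Rightarrow> bool" where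
  "input_mem M \<longleftrightarrow> (\<forall>i<n. M i = vs ! i) \<and>
     (\<forall>j<m. M (n + 2 * j) = fst (es ! j) \<and> M (Suc (n + 2 * j)) = snd (es ! j))"

definition mark_mem :: "(nat \<Rightarrow> nat) \<Rightarrow> bool" where
  "mark_mem M \<longleftrightarrow> (\<forall>v<n. M (aMark + v) = of_bool (v \<in> cov))"

lemma wp_mark_prog:
  assumes R: "regs0 R" and M: "input_mem M" "\<forall>a\<ge>aMark. M a = 0"
  shows "wp mark_prog (\<lambda>t R' M'. t \<le> 5 + m * 19 \<and> R' rC = c \<and> mark_mem M' \<and>
     (\<forall>a. a < aMark \<or> aPos \<le> a \<longrightarrow> M' a = M a)) R M"
proof -
  define P where "P k M' \<longleftrightarrow> (\<forall>v<n. M' (aMark + v) = of_bool (v \<in> marked k)) \<and>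
       (\<forall>a. a < aMark \<or> aPos \<le> a \<longrightarrow> M' a = M a)" for k M'
  have "wp (For 30 39 rM mark_body) (\<lambda>t R' M'. t \<le> 3 + m * (15 + 4) \<and>
      (R' 31 = n + 2 * m \<and> R' rC = card (marked m) \<and> P m M')) (R(rC := 0, 31 := n)) M"
  proof (rule wp_For[where Inv = "\<lambda>k R' M'. R' 31 = n + 2 * k \<and> R' rC = card (marked k) \<and> P k M'"], goal_cases)
    \<comment> \<open>Case 9 is the premise \<open>step\<close> of \<open>wp_For\<close>; the others
      are side conditions settled at the end. The same holds for all loops below.\<close>
    case (9 k R' M')
    let ?u = "fst (es ! k)" and ?v = "snd (es ! k)"
    have r: "R' rMark = aMark" "R' 31 = n + 2 * k" using 9 R by (simp_all add: regs0_def mark_body_def)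
    note b = es_in[OF 9(1)]
    have u: "M' (n + 2 * k) = ?u" "M' (Suc (n + 2 * k)) = ?v" "M' (aMark + ?u) = of_bool (?u \<in> marked k)"
      "M' (aMark + ?v) = of_bool (?v \<in> marked k)"
      using 9 M(1) b by (auto simp: input_mem_def aMark_def P_def)
    show ?case
    proof (cases "?u \<in> marked k \<or> ?v \<in> marked k")
      case True
      have "P (Suc k) M'" using 9(3) True by (auto simp: P_def)
      then show ?thesis unfolding mark_body_def using True 9(3) by (auto simp: r u)
    next
      case False
      have "P (Suc k) (M'(aMark + ?u := Suc 0, aMark + ?v := Suc 0))"
        using 9(3) False b by (auto simp: P_def aPos_def)
      then show ?thesis unfolding mark_body_def using False 9(3) card_marked_Suc[OF 9(1) False]
        by (simp add: r u del: marked.simps)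
    qed
  qed (use R M in \<open>auto simp: mark_body_def regs0_def P_def\<close>)
  then show ?thesis
    unfolding mark_prog_def using R
    by (auto elim!: wp_mono simp: regs0_def c_def cov_def mark_mem_def P_def)
qed

definition vert_mem :: "(nat \<Rightarrow> nat) \<Rightarrow> bool" where
  "vert_mem M \<longleftrightarrow> (\<forall>v<n. M (aPos + v) = pos v \<and> M (aRow + v) = 2 * c * pos v \<and>
     M (aCnt + v) = cnt v \<and> M (aCls + v) = cls v * c)"

lemma wp_scan_prog:
  assumes R: "regs1 R" and M: "input_mem M" "mark_mem M"
  shows "wp scan_prog (\<lambda>t R' M'. t \<le> 6 + n * 22 \<and> vert_mem M' \<and>
     (\<forall>a. a < aPos \<or> aTy \<le> a \<longrightarrow> M' a = M a)) R M"
proof -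
  define P where "P k M' \<longleftrightarrow> 
    (\<forall>j<k. M' (aPos + vs ! j) = j \<and> M' (aRow + vs ! j) = 2 * c * j \<and> M' (aCnt + vs ! j) = cntp j \<and>
        M' (aCls + vs ! j) = (2 * cntp j + of_bool (vs ! j \<in> cov)) * c) \<and>
    (\<forall>a. a < aPos \<or> aTy \<le> a \<longrightarrow> M' a = M a)" for k M'
  have "wp (For 30 39 rN scan_body) (\<lambda>t R' M'. t \<le> 3 + n * (18 + 4) \<and>
        (R' 31 = 2 * c * n \<and> R' 32 = cntp n \<and> R' 33 = 2 * cntp n * c \<and> P n M'))
      (R(31 := 0, 32 := 0, 33 := 0)) M"
  proof (rule wp_For[where Inv = "\<lambda>k R' M'. R' 31 = 2 * c * k \<and> R' 32 = cntp k \<and>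
      R' 33 = 2 * cntp k * c \<and> P k M'"], goal_cases)
    case (9 k R' M')
    have r: "R' rMark = aMark" "R' rPos = aPos" "R' rRow = aRow" "R' rCls = aCls" "R' rCnt = aCnt"
        "R' rC = c" "R' rC2 = 2 * c" "R' 31 = 2 * c * k" "R' 32 = cntp k" "R' 33 = 2 * cntp k * c" "R' 30 = k"
      using 9 R by (simp_all add: regs1_def regs0_def scan_body_def)
    have v: "vs ! k < n" using 9(1) set_vs n_def nth_mem by blast
    have j: "vs ! j < n" "vs ! j \<noteq> vs ! k" if "j < k" for j
      using that 9(1) set_vs distinct_vs n_def nth_mem[of j vs] by (auto simp: nth_eq_iff_index_eq)
    have l: "M' k = vs ! k" "M' (aMark + vs ! k) = of_bool (vs ! k \<in> cov)"
      using 9(1,3) M v by (auto simp: input_mem_def mark_mem_def aPos_def aMark_def P_def)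
    have P: "P (Suc k) (M'(aPos + vs ! k := k, aRow + vs ! k := 2 * c * k, aCnt + vs ! k := cntp k,
        aCls + vs ! k := x))" if x: "x = (2 * cntp k + of_bool (vs ! k \<in> cov)) * c" for x
      unfolding P_def
    proof (intro conjI allI impI, goal_cases)
      case (1 j) then show ?case using 9(3) j[of j] v by (cases "j = k") (auto simp: addr_defs P_def less_Suc_eq)
    next
      case (2 j) then show ?case using 9(3) j[of j] v by (cases "j = k") (auto simp: addr_defs P_def less_Suc_eq)
    next
      case (3 j) then show ?case using 9(3) j[of j] v by (cases "j = k") (auto simp: addr_defs P_def less_Suc_eq)
    next
      case (4 j) then show ?case using 9(3) j[of j] v x by (cases "j = k") (auto simp: addr_defs P_def less_Suc_eq)
    next
      case (5 a) then show ?case using 9(3) v by (auto simp: addr_defs P_def)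
    qed
    show ?case
    proof (cases "vs ! k \<in> cov")
      case True
      have "P (Suc k) (M'(aPos + vs ! k := k, aRow + vs ! k := 2 * c * k, aCnt + vs ! k := cntp k,
          aCls + vs ! k := 2 * cntp k * c + c))"
        by (rule P) (simp add: True distrib_right)
      then show ?thesis unfolding scan_body_def using True by (simp add: r l cntp_Suc distrib_right)
    next
      case False
      have "P (Suc k) (M'(aPos + vs ! k := k, aRow + vs ! k := 2 * c * k, aCnt + vs ! k := cntp k,
          aCls + vs ! k := 2 * cntp k * c))"
        by (rule P) (simp add: False)
      then show ?thesis unfolding scan_body_def using False by (simp add: r l cntp_Suc)
    qed
  qed (use R in \<open>auto simp: scan_body_def regs1_def regs0_def P_def\<close>)
  moreover have "vert_mem M'" if "P n M'" for M'
    unfolding vert_mem_def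
  proof (intro allI impI)
    fix v assume "v < n"
    then have "pos v < n" "vs ! pos v = v" using pos by auto
    then show "M' (aPos + v) = pos v \<and> M' (aRow + v) = 2 * c * pos v \<and>
       M' (aCnt + v) = cnt v \<and> M' (aCls + v) = cls v * c"
      using that unfolding P_def cnt_def cls_def by metis
  qed
  ultimately show ?thesis
    unfolding scan_prog_def by (auto elim!: wp_mono simp: P_def)
qed

definition edge_mem :: "(nat \<Rightarrow> nat) \<Rightarrow> bool" where
  "edge_mem M \<longleftrightarrow> (\<forall>e<m. M (aTy + e) = ty e \<and> M (aLft + e) = lft e \<and> M (aRgt + e) = rgt e)"

definition slot_mem :: "(nat \<Rightarrow> nat) \<Rightarrow> bool" where
  "slot_mem M \<longleftrightarrow> (\<forall>e<m. M (aSlot + key e) = Suc e) \<and>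
     (\<forall>t<2 * c * n. (\<forall>e<m. key e \<noteq> t) \<longrightarrow> M (aSlot + t) = 0)"

lemma wp_edges_prog:
  assumes R: "regs1 R" and M: "input_mem M" "mark_mem M" "vert_mem M" "\<forall>a\<ge>aTy. M a = 0"
  shows "wp edges_prog (\<lambda>t R' M'. t \<le> 4 + m * 42 \<and> edge_mem M' \<and> slot_mem M' \<and>
     (\<forall>a. a < aTy \<or> aLo \<le> a \<longrightarrow> M' a = M a)) R M"
proof -
  define P where "P k M' \<longleftrightarrow>
    (\<forall>e<k. M' (aTy + e) = ty e \<and> M' (aLft + e) = lft e \<and> M' (aRgt + e) = rgt e \<and>
        M' (aSlot + key e) = Suc e) \<and>
    (\<forall>t<2 * c * n. (\<forall>e<k. key e \<noteq> t) \<longrightarrow> M' (aSlot + t) = 0) \<and>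
    (\<forall>a. a < aTy \<or> aLo \<le> a \<longrightarrow> M' a = M a)" for k M'
  have "wp (For 30 39 rM edges_body) (\<lambda>t R' M'. t \<le> 3 + m * (38 + 4) \<and>
        (R' 31 = n + 2 * m \<and> P m M')) (R(31 := n)) M"
  proof (rule wp_For[where Inv = "\<lambda>k R' M'. R' 31 = n + 2 * k \<and> P k M'"], goal_cases)
    case (9 k R' M')
    let ?u = "fst (es ! k)" and ?v = "snd (es ! k)" and ?s = "src k" and ?t = "tgt k"
    have r: "R' rMark = aMark" "R' rPos = aPos" "R' rRow = aRow" "R' rCls = aCls" "R' rCnt = aCnt"
        "R' rTy = aTy" "R' rLft = aLft" "R' rRgt = aRgt" "R' rSlot = aSlot"
        "R' rC = c" "R' 31 = n + 2 * k" "R' 30 = k"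
      using 9 R by (simp_all add: regs1_def regs0_def edges_body_def)
    note b = es_in[OF 9(1)] and st = src_tgt[OF 9(1)]
    have old: "M' a = M a" if "a < aTy" for a using 9(3) that by (simp add: P_def)
    have u: "M' (n + 2 * k) = ?u" "M' (Suc (n + 2 * k)) = ?v" "M' (aMark + ?v) = of_bool (?v \<in> cov)"
      using 9(1) M(1,2) b by (auto simp: old input_mem_def mark_mem_def addr_defs aMark_def)
    have l: "M' (aCnt + ?t) = cnt ?t" "M' (aCls + ?s) = cls ?s * c" "M' (aPos + ?s) = pos ?s"
      "M' (aPos + ?t) = pos ?t" "M' (aRow + ?s) = 2 * c * pos ?s"
      using M(3) st(1,2) by (auto simp: old vert_mem_def addr_defs)
    have P: "P (Suc k) (M'(aTy + k := ty k, aLft + k := lft k, aRgt + k := rgt k, aSlot + key k := Suc k))"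
    proof -
      have k: "key k < 2 * c * n" "k < m" using key_less 9(1) by auto
      \<comment> \<open>Keys are injective, so the new entry overwrites no slot filled
        earlier.\<close>
      have e: "e < m" "key e < 2 * c * n" "key e \<noteq> key k" if "e < k" for e
        using that k key_less key_inject[of e k] by auto
      show ?thesis
        unfolding P_def
      proof (intro conjI allI impI, goal_cases)
        case (1 j) then show ?case using 9(3) e[of j] k by (cases "j = k") (auto simp: addr_defs P_def less_Suc_eq)
      next
        case (2 j) then show ?case using 9(3) e[of j] k by (cases "j = k") (auto simp: addr_defs P_def less_Suc_eq)
      next
        case (3 j) then show ?case using 9(3) e[of j] k by (cases "j = k") (auto simp: addr_defs P_def less_Suc_eq)
      next
        case (4 j) then show ?case using 9(3) e[of j] k by (cases "j = k") (auto simp: addr_defs P_def less_Suc_eq)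
      next
        case (5 t) then show ?case using 9(3) k by (auto simp: addr_defs P_def less_Suc_eq)
      next
        case (6 a)
        then have "a \<noteq> aTy + k" "a \<noteq> aLft + k" "a \<noteq> aRgt + k" "a \<noteq> aSlot + key k"
          using k by (auto simp: addr_defs)
        then show ?case using 9(3) 6 by (auto simp: P_def)
      qed
    qed
    \<comment> \<open>The summands stand in the order in which \<open>edges_body\<close> adds them,
      to match the address it computes.\<close>
    have addr: "aSlot + key k = c - 1 - cnt ?t + 2 * c * pos ?s + aSlot + (if pos ?s < pos ?t then c else 0)"
      by (simp add: key_def)
    have lr: "pos ?s < pos ?t \<Longrightarrow> lft k = pos ?s \<and> rgt k = pos ?t"
      "\<not> pos ?s < pos ?t \<Longrightarrow> lft k = pos ?t \<and> rgt k = pos ?s"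
      by (auto simp: lft_def rgt_def)
    show ?case
    proof (cases "?v \<in> cov"; cases "pos ?s < pos ?t")
      assume a: "?v \<in> cov" "pos ?s < pos ?t"
      then have "M' (n + 2 * k) = ?s" "M' (Suc (n + 2 * k)) = ?t" "M' (aMark + ?t) = 1"
        using u by (simp_all add: src_def tgt_def)
      then show ?thesis unfolding edges_body_def using P a(2) lr by (simp add: r l addr ty_def)
    next
      assume a: "?v \<in> cov" "\<not> pos ?s < pos ?t"
      then have "M' (n + 2 * k) = ?s" "M' (Suc (n + 2 * k)) = ?t" "M' (aMark + ?t) = 1"
        using u by (simp_all add: src_def tgt_def)
      then show ?thesis unfolding edges_body_def using P a(2) lr by (simp add: r l addr ty_def)
    next
      assume a: "?v \<notin> cov" "pos ?s < pos ?t"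
      then have "M' (n + 2 * k) = ?t" "M' (Suc (n + 2 * k)) = ?s" "M' (aMark + ?s) = 0"
        using u by (simp_all add: src_def tgt_def)
      then show ?thesis unfolding edges_body_def using P a(2) lr by (simp add: r l addr ty_def)
    next
      assume a: "?v \<notin> cov" "\<not> pos ?s < pos ?t"
      then have "M' (n + 2 * k) = ?t" "M' (Suc (n + 2 * k)) = ?s" "M' (aMark + ?s) = 0"
        using u by (simp_all add: src_def tgt_def)
      then show ?thesis unfolding edges_body_def using P a(2) lr by (simp add: r l addr ty_def)
    qed
  qed (use R M(4) in \<open>auto simp: edges_body_def regs1_def regs0_def P_def addr_defs\<close>)
  then show ?thesis
    unfolding edges_prog_def using R
    by (auto elim!: wp_mono simp: regs1_def regs0_def P_def edge_mem_def slot_mem_def)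
qed

definition ord_mem :: "(nat \<Rightarrow> nat) \<Rightarrow> bool" where
  "ord_mem M \<longleftrightarrow> (\<forall>t<m. M (aOrd + t) = item t)"

lemma wp_sort_prog:
  assumes R: "regs1 R" and M: "slot_mem M"
  shows "wp sort_prog (\<lambda>t R' M'. t \<le> 4 + 2 * c * n * 12 \<and> ord_mem M' \<and>
     (\<forall>a. a < aOrd \<or> aSlot \<le> a \<longrightarrow> M' a = M a)) R M"
proof -
  define P where "P k M' \<longleftrightarrow> (\<forall>i<length (sorted_edges k). M' (aOrd + i) = sorted_edges k ! i) \<and>
    (\<forall>a. a < aOrd \<or> aSlot \<le> a \<longrightarrow> M' a = M a)" for k M'
  have "wp (For 30 39 rS sort_body) (\<lambda>t R' M'. t \<le> 3 + 2 * c * n * (8 + 4) \<and>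
        (R' 31 = length (sorted_edges (2 * c * n)) \<and> P (2 * c * n) M')) (R(31 := 0)) M"
  proof (rule wp_For[where Inv = "\<lambda>k R' M'. R' 31 = length (sorted_edges k) \<and> P k M'"], goal_cases)
    case (9 k R' M')
    have r: "R' rOrd = aOrd" "R' rSlot = aSlot" "R' 31 = length (sorted_edges k)" "R' 30 = k"
      using 9 R by (simp_all add: regs1_def regs0_def sort_body_def)
    have old: "M' (aSlot + k) = M (aSlot + k)" using 9(3) by (simp add: P_def)
    show ?case
    proof (cases "\<exists>e<m. key e = k")
      case True
      then obtain e where e: "e < m" "key e = k" by auto
      then have s: "sorted_edges (Suc k) = sorted_edges k @ [e]" using the_key[of e] by auto
      have "M (aSlot + k) = Suc e" using M e by (auto simp: slot_mem_def)
      \<comment> \<open>The list for \<open>Suc k\<close> is one longer and still has at most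
        \<open>m\<close> entries, so this write stays below \<open>aSlot\<close>.\<close>
      moreover have "length (sorted_edges k) < m"
        using length_sorted_edges_le[of "Suc k"] s by simp
      then have "P (Suc k) (M'(aOrd + length (sorted_edges k) := e))"
        using 9(3) unfolding P_def s by (auto simp: nth_append less_Suc_eq aSlot_def)
      ultimately show ?thesis
        unfolding sort_body_def by (simp add: r s old del: sorted_edges.simps)
    next
      case False
      then have s: "sorted_edges (Suc k) = sorted_edges k" by simp
      have "M (aSlot + k) = 0" using M False 9(1) by (auto simp: slot_mem_def)
      moreover have "P (Suc k) M'" using 9(3) unfolding P_def s by simp
      ultimately show ?thesis
        unfolding sort_body_def by (simp add: r s old del: sorted_edges.simps)
    qed
  qed (use R in \<open>auto simp: sort_body_def regs1_def regs0_def P_def\<close>)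
  then show ?thesis
    unfolding sort_prog_def
    by (auto elim!: wp_mono simp: P_def ord_mem_def item_def length_sorted_edges_all)
qed

definition rep_mem :: "(nat \<Rightarrow> nat) \<Rightarrow> bool" where
  "rep_mem M \<longleftrightarrow> (\<forall>y<W. M (aLo + y) = rep lft m y \<and> M (aHi + y) = rep rgt m y)"

text \<open>Types without any edge keep the 0 of untouched memory, in agreement with
  \<open>rep f 0\<close>.\<close>

lemma wp_rep_prog:
  assumes R: "regs1 R" and M: "edge_mem M" "ord_mem M" "\<forall>a\<ge>aLo. M a = 0"
  shows "wp rep_prog (\<lambda>t R' M'. t \<le> 3 + m * 19 \<and> rep_mem M' \<and>
     (\<forall>a. a < aLo \<or> aBits \<le> a \<longrightarrow> M' a = M a)) R M"
proof -
  define P where "P k M' \<longleftrightarrow> (\<forall>y<W. M' (aLo + y) = rep lft k y \<and> M' (aHi + y) = rep rgt k y) \<and>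
    (\<forall>a. a < aLo \<or> aBits \<le> a \<longrightarrow> M' a = M a)" for k M'
  have "wp (For 30 39 rM rep_body) (\<lambda>t R' M'. t \<le> 3 + m * (15 + 4) \<and> P m M') R M"
  proof (rule wp_For[where Inv = "\<lambda>k R' M'. P k M'"], goal_cases)
    case (9 k R' M')
    let ?e = "item (m - Suc k)"
    have r: "R' (Suc 0) = m" "R' rOrd = aOrd" "R' rTy = aTy" "R' rLft = aLft" "R' rRgt = aRgt"
      "R' rLo = aLo" "R' rHi = aHi" "R' 30 = k"
      using 9 R by (simp_all add: regs1_def regs0_def rep_body_def)
    have e: "?e < m" "m - Suc k < m" using 9(1) by (auto intro: item_less)
    have y: "ty ?e < W" using ty_less e by simp
    have l: "M' (aOrd + (m - Suc k)) = ?e" "M' (aTy + ?e) = ty ?e" "M' (aLft + ?e) = lft ?e"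
      "M' (aRgt + ?e) = rgt ?e"
      using M(1,2) e 9(3) by (auto simp: P_def edge_mem_def ord_mem_def addr_defs)
    have "P (Suc k) (M'(aLo + ty ?e := lft ?e, aHi + ty ?e := rgt ?e))"
      using 9(3) y unfolding P_def by (auto simp: aHi_def aBits_def)
    then show ?case
      unfolding rep_body_def by (simp add: r l del: rep.simps)
  qed (use R M in \<open>auto simp: rep_body_def regs1_def regs0_def P_def addr_defs\<close>)
  then show ?thesis
    unfolding rep_prog_def by (auto elim!: wp_mono simp: P_def rep_mem_def)
qed

definition pow_mem :: "(nat \<Rightarrow> nat) \<Rightarrow> bool" where
  "pow_mem M \<longleftrightarrow> (\<forall>b<D. M (aPow + b) = 2 ^ b)"

lemma wp_pow_prog:
  assumes R: "regs1 R"
  shows "wp pow_prog (\<lambda>t R' M'. t \<le> 4 + D * 7 \<and> R' rB = 2 ^ D \<and> pow_mem M' \<and>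
     (\<forall>a. a < aPow \<or> aVal \<le> a \<longrightarrow> M' a = M a)) R M"
proof -
  define P where "P k M' \<longleftrightarrow> (\<forall>b<k. M' (aPow + b) = 2 ^ b) \<and>
    (\<forall>a. a < aPow \<or> aVal \<le> a \<longrightarrow> M' a = M a)" for k M'
  have "wp (For 30 39 rD (Add 31 rPow 30 ;; Store 31 rB ;; Add rB rB rB))
     (\<lambda>t R' M'. t \<le> 3 + D * (3 + 4) \<and> (R' rB = 2 ^ D \<and> P D M')) (R(rB := 1)) M"
  proof (rule wp_For[where Inv = "\<lambda>k R' M'. R' rB = 2 ^ k \<and> P k M'"], goal_cases)
    case (9 k R' M')
    have r: "R' rPow = aPow" "R' 30 = k"
      using 9 R by (simp_all add: regs1_def regs0_def)
    have "P (Suc k) (M'(aPow + k := 2 ^ k))"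
      using 9(1,3) unfolding P_def by (auto simp: aVal_def less_Suc_eq)
    then show ?case using 9(3) by (simp add: r)
  qed (use R in \<open>auto simp: regs1_def regs0_def P_def\<close>)
  then show ?thesis
    unfolding pow_prog_def by (auto elim!: wp_mono simp: P_def pow_mem_def)
qed

end

section \<open>Evaluating one table entry\<close>

text \<open>Binary expansion from the top bit by trial subtraction. Under truncated subtraction,
  \<open>a \<ge> b\<close> is tested by whether \<open>a + 1 - b\<close> is nonzero.\<close>

definition decode_body :: prog where
  "decode_body =
     Imm 67 1 ;; Sub 64 64 67 ;; Add 68 rPow 64 ;; Load 69 68 ;; Add 70 rBits 64 ;;
     Add 71 63 67 ;; Sub 71 71 69 ;;
     Cond 71 (Sub 63 63 69 ;; Store 70 67) (Imm 67 0 ;; Store 70 67)"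

definition decode_prog :: prog where
  "decode_prog = Move 63 50 ;; Move 64 rD ;; For 65 66 rD decode_body"

definition cross_test :: prog where
  "cross_test =
     Sub 79 51 77 ;;
     Cond 79
       (Sub 79 78 51 ;; Cond 79 (Sub 79 52 78 ;; Cond 79 (Imm 73 0) Skip) Skip)
       (Sub 79 77 51 ;; Cond 79 (Sub 79 52 77 ;; Cond 79 (Sub 79 78 52 ;; Cond 79 (Imm 73 0) Skip) Skip) Skip)"

definition check_body :: prog where
  "check_body =
     Add 76 rBits 72 ;; Add 76 76 74 ;; Load 76 76 ;;
     Cond 76 (Add 77 rLo 74 ;; Load 77 77 ;; Add 78 rHi 74 ;; Load 78 78 ;; cross_test) Skip"

definition check_prog :: prog where
  "check_prog = Imm 73 1 ;; For 74 75 rW check_body"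

text \<open>Setting a bit means adding its power of two unless it is already set, and a maximum is
  obtained as \<open>b + (a - b)\<close> with truncated subtraction. Register 72 holds
  \<open>p * W\<close> as a running sum.\<close>

definition update_prog :: prog where
  "update_prog =
     Add 82 72 53 ;; Add 83 rBits 82 ;; Load 83 83 ;;
     Cond 83 (Move 84 50) (Add 83 rPow 82 ;; Load 83 83 ;; Add 84 50 83) ;;
     Add 85 54 84 ;; Load 85 85 ;; Imm 86 1 ;; Add 86 80 86 ;;
     Sub 87 86 85 ;; Add 87 85 87 ;;
     Cond 73 (Sub 88 60 87 ;; Cond 88 (Move 60 87 ;; Move 61 86 ;; Move 62 84) Skip) Skip ;;
     Add 72 72 rW"

definition page_body :: prog where
  "page_body = check_prog ;; update_prog"

definition eval_prog :: prog where
  "eval_prog =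
     decode_prog ;; Imm 72 0 ;; Imm 60 1 ;; Add 60 60 rC ;; Imm 61 0 ;; Imm 62 0 ;;
     For 80 81 rC page_body"

lemmas eval_defs = decode_body_def decode_prog_def cross_test_def check_body_def check_prog_def
  update_prog_def page_body_def eval_prog_def

lemma writes_eval_progs:
  "writes eval_prog \<subseteq> {60..88}" "writes decode_prog \<subseteq> {60..88}" "writes page_body \<subseteq> {60..88}"
  "writes check_prog \<subseteq> {73..79}"
  by (auto simp: eval_defs)

lemma take_bit_Suc_nat: "take_bit (Suc b) s = take_bit b s + of_bool (bit s b) * 2 ^ b" for s :: nat
proof -
  have "s mod (2 ^ b * 2) = 2 ^ b * (s div 2 ^ b mod 2) + s mod 2 ^ b" by (rule mod_mult2_eq)
  then show ?thesis by (simp add: take_bit_eq_mod bit_iff_odd mult.commute mod_2_eq_odd)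
qed

lemma wp_cross_test:
  "wp cross_test (\<lambda>t R' M'. t \<le> 9 \<and>
     R' 73 = (if crosses (R 77) (R 78) (R 51) (R 52) then 0 else R 73) \<and> M' = M) R M"
  by (auto simp: cross_test_def crosses_def)

context ordered_graph
begin

definition bits_mem :: "nat \<Rightarrow> (nat \<Rightarrow> nat) \<Rightarrow> bool" where
  "bits_mem s M \<longleftrightarrow> (\<forall>b<D. M (aBits + b) = of_bool (bit s b))"

lemma wp_decode_prog:
  assumes R: "regs1 R" "R 50 = s" "s < 2 ^ D" and M: "pow_mem M"
  shows "wp decode_prog (\<lambda>t R' M'. t \<le> 5 + D * 14 \<and> bits_mem s M' \<and>
     (\<forall>a. a < aBits \<or> aPow \<le> a \<longrightarrow> M' a = M a)) R M"
proof -
  define P where "P k M' \<longleftrightarrow> (\<forall>b<D. D - k \<le> b \<longrightarrow> M' (aBits + b) = of_bool (bit s b)) \<and>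
    (\<forall>a. a < aBits \<or> aPow \<le> a \<longrightarrow> M' a = M a)" for k M'
  have "wp (For 65 66 rD decode_body) (\<lambda>t R' M'. t \<le> 3 + D * (10 + 4) \<and>
      (R' 64 = D - D \<and> R' 63 = take_bit (D - D) s \<and> P D M')) (R(63 := s, 64 := D)) M"
  proof (rule wp_For[where Inv = "\<lambda>k R' M'. R' 64 = D - k \<and> R' 63 = take_bit (D - k) s \<and> P k M'"], goal_cases)
    case (9 k R' M')
    define b where "b = D - Suc k"
    have b: "b < D" "D - k = Suc b" "D - Suc k = b" using 9(1) by (auto simp: b_def)
    have r: "R' rPow = aPow" "R' rBits = aBits" "R' 64 = Suc b"
        "R' 63 = take_bit b s + of_bool (bit s b) * 2 ^ b"
      using 9 R b(2) by (simp_all add: regs1_def regs0_def decode_body_def take_bit_Suc_nat)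
    have l: "M' (aPow + b) = 2 ^ b"
    proof -
      have "M' (aPow + b) = M (aPow + b)" using 9(3) unfolding P_def by (meson le_add1)
      then show ?thesis using M b(1) unfolding pow_mem_def by metis
    qed
    have lt: "take_bit b s < 2 ^ b" by simp
    have P: "P (Suc k) (M'(aBits + b := of_bool (bit s b)))"
      using 9(3) b unfolding P_def b(2,3) by (auto simp: aPow_def)
    show ?case
    proof (cases "bit s b")
      case True
      then show ?thesis using P unfolding decode_body_def by (simp add: r l b(3))
    next
      case False
      have "Suc (take_bit b s) - 2 ^ b = 0" using lt by (simp del: take_bit_nat_less_exp)
      then show ?thesis using P False unfolding decode_body_def by (simp add: r l b(3))
    qed
  qed (use R in \<open>auto simp: decode_body_def regs1_def regs0_def P_def take_bit_nat_eq_self\<close>)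
  then show ?thesis
    unfolding decode_prog_def using R
    by (auto elim!: wp_mono simp: regs1_def P_def bits_mem_def)
qed

lemma wp_check_prog:
  assumes R: "regs1 R" "R 72 = p * W" "p < c" "R 51 = lft (item t)" "R 52 = rgt (item t)"
    and M: "bits_mem s M" "rep_mem M"
  shows "wp check_prog (\<lambda>t' R' M'. t' \<le> 4 + W * 21 \<and> R' 73 = of_bool (dp.page_ok s t p) \<and> M' = M) R M"
proof -
  let ?ok = "\<lambda>k. \<forall>y<k. bit s (p * W + y) \<longrightarrow> \<not> crosses (rep lft m y) (rep rgt m y) (lft (item t)) (rgt (item t))"
  have "wp (For 74 75 rW check_body) (\<lambda>t R' M'. t \<le> 3 + W * (17 + 4) \<and>
      (R' 73 = of_bool (?ok W) \<and> M' = M)) (R(73 := 1)) M"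
  proof (rule wp_For[where Inv = "\<lambda>k R' M'. R' 73 = of_bool (?ok k) \<and> M' = M"], goal_cases)
    case (9 k R' M')
    have "p * W + k < Suc p * W" using 9(1) by simp
    also have "\<dots> \<le> D" unfolding D_def using R(3) by (metis Suc_leI mult.commute mult_le_mono2)
    finally have k: "p * W + k < D" .
    have r: "R' rLo = aLo" "R' rHi = aHi" "R' rBits = aBits" "R' 72 = p * W" "R' 74 = k"
        "R' 51 = lft (item t)" "R' 52 = rgt (item t)" "M' = M"
      using 9 R by (simp_all add: regs1_def regs0_def check_body_def cross_test_def)
    have l: "M (aBits + p * W + k) = of_bool (bit s (p * W + k))"
      "M (aLo + k) = rep lft m k" "M (aHi + k) = rep rgt m k"
      using M k 9(1) by (simp_all add: bits_mem_def rep_mem_def add.assoc)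
    have ok: "?ok (Suc k) \<longleftrightarrow> ?ok k \<and> (bit s (p * W + k) \<longrightarrow>
       \<not> crosses (rep lft m k) (rep rgt m k) (lft (item t)) (rgt (item t)))"
      by (auto simp: less_Suc_eq)
    show ?case
    proof (cases "bit s (p * W + k)")
      case True
      then show ?thesis unfolding check_body_def ok
        apply (simp add: r l split del: split_of_bool)
        apply (rule wp_mono[OF wp_cross_test])
        using 9(3) by (auto simp: r)
    next
      case False
      then show ?thesis using 9(3) unfolding check_body_def ok by (simp add: r l)
    qed
  qed (use R in \<open>auto simp: check_body_def cross_test_def regs1_def regs0_def\<close>)
  then show ?thesis
    unfolding check_prog_def using R
    by (auto elim!: wp_mono simp: dp.page_ok_def)
qed

lemma wp_update_prog:
  assumes R: "regs1 R" "R 72 = p * W" "p < c" "R 53 = ty (item t)" "R 80 = p" "R 50 = s" "R 54 = row"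
      "R 73 = of_bool (dp.page_ok s t p)" "(R 60, R 61, R 62) = dp.choose_page v s t p"
    and M: "bits_mem s M" "pow_mem M" "\<And>s'. s' < 2 ^ D \<Longrightarrow> M (row + s') = v s'"
    and st: "s < 2 ^ D" "t < m"
  shows "wp update_prog (\<lambda>t' R' M'. t' \<le> 20 \<and> R' 72 = Suc p * W \<and>
     (R' 60, R' 61, R' 62) = dp.choose_page v s t (Suc p) \<and> M' = M) R M"
proof -
  let ?b = "p * W + ty (item t)" and ?s = "dp.next_state s t p"
  have "?b < Suc p * W" using dp.T_less[OF st(2)] by simp
  also have "\<dots> \<le> D" unfolding D_def using R(3) by (metis Suc_leI mult.commute mult_le_mono2)
  finally have b: "?b < D" .
  have l: "M (aBits + ?b) = of_bool (bit s ?b)" "M (aPow + ?b) = 2 ^ ?b" "M (row + ?s) = v ?s"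
    using M b dp.next_state_less[OF _ st(2) R(3)] st(1) by (auto simp: bits_mem_def pow_mem_def D_def)
  have r: "R rBits = aBits" "R rPow = aPow" "R rW = W" using R(1) by (simp_all add: regs1_def)
  have c: "R 60 = fst (dp.choose_page v s t p)" "R 61 = fst (snd (dp.choose_page v s t p))"
    "R 62 = snd (snd (dp.choose_page v s t p))" using R(9) by (metis fst_conv snd_conv)+
  have mx: "a + (Suc p - a) = max (Suc p) a" for a by auto
  have nx: "bit s ?b \<Longrightarrow> ?s = s" "\<not> bit s ?b \<Longrightarrow> ?s = s + 2 ^ ?b"
    subgoal by (rule bit_eqI) (auto simp: dp.next_state_def bit_simps)
    subgoal
    proof -
      assume nb: "\<not> bit s ?b"
      then have "s + 2 ^ ?b = or s (2 ^ ?b)" by (intro disjunctive_add) (auto simp: bit_simps)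
      also have "\<dots> = ?s" by (simp add: dp.next_state_def set_bit_eq_or push_bit_eq_mult)
      finally show ?thesis ..
    qed
    done
  show ?thesis
  proof (cases "bit s ?b")
    case True
    then show ?thesis
      unfolding update_prog_def using l(3) nx(1)[OF True]
      by (auto simp: r R(2-8) l(1,2) c mx not_less)
  next
    case False
    then show ?thesis
      unfolding update_prog_def using l(3) nx(2)[OF False]
      by (auto simp: r R(2-8) l(1,2) c mx not_less)
  qed
qed

text \<open>Stated for an arbitrary row \<open>v\<close>, since both the filling and the reading of
  the table use it. The only memory written is the bit array, and \<open>aVal \<le> row\<close>
  keeps the row clear of it.\<close>

lemma wp_eval_prog:
  assumes R: "regs1 R" "R 50 = s" "R 51 = lft (item t)" "R 52 = rgt (item t)" "R 53 = ty (item t)" "R 54 = row"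
    and M: "rep_mem M" "pow_mem M" "\<And>s'. s' < 2 ^ D \<Longrightarrow> M (row + s') = v s'" "aVal \<le> row"
    and st: "s < 2 ^ D" "t < m"
  shows "wp eval_prog (\<lambda>t' R' M'. t' \<le> 13 + D * 35 + c * 28 \<and>
     (R' 60, R' 61, R' 62) = dp.choose_page v s t c \<and>
     (\<forall>a. a < aBits \<or> aPow \<le> a \<longrightarrow> M' a = M a)) R M"
proof -
  have loop: "wp (For 80 81 rC page_body) (\<lambda>t' R' M'. t' \<le> 3 + c * ((24 + W * 21) + 4) \<and>
      (R' 72 = c * W \<and> (R' 60, R' 61, R' 62) = dp.choose_page v s t c \<and> M' = M1))
      (R1(72 := 0, 60 := Suc c, 61 := 0, 62 := 0)) M1"
    if R1: "\<And>r. r \<notin> writes decode_prog \<Longrightarrow> R1 r = R r"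
      and M1: "bits_mem s M1" "\<And>a. a < aBits \<or> aPow \<le> a \<Longrightarrow> M1 a = M a" for R1 M1
  proof (rule wp_For[where Inv = "\<lambda>k R' M'. R' 72 = k * W \<and>
      (R' 60, R' 61, R' 62) = dp.choose_page v s t k \<and> M' = M1"], goal_cases)
    case (9 k R' M')
    have fr: "R' r = R r" if "r \<notin> {60..88}" for r
    proof -
      have "r \<notin> writes decode_prog" "r \<notin> {80, 81} \<union> writes page_body"
        using that writes_eval_progs by auto
      then show ?thesis using 9(4)[of r] R1[of r] that by auto
    qed
    have r: "regs1 R'" "R' 50 = s" "R' 51 = lft (item t)" "R' 52 = rgt (item t)" "R' 53 = ty (item t)" "R' 54 = row"
      using R by (simp_all add: fr regs1_def regs0_def)
    have mem: "rep_mem M1" "pow_mem M1" "\<And>s'. s' < 2 ^ D \<Longrightarrow> M1 (row + s') = v s'"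
      using M by (auto simp: rep_mem_def pow_mem_def M1(2) addr_defs)
    have ch: "wp check_prog (\<lambda>t' R'' M''. t' \<le> 4 + W * 21 \<and> R'' 73 = of_bool (dp.page_ok s t k) \<and> M'' = M1) R' M'"
    proof -
      have "M' = M1" "R' 72 = k * W" using 9(3) by auto
      then show ?thesis using wp_check_prog[OF r(1) _ 9(1) r(3,4) M1(1) mem(1)] by simp
    qed
    show ?case
      unfolding page_body_def wp_Seq
    proof (rule wp_use[OF ch], goal_cases)
      case (1 t1 R2 M2)
      have fr2: "R2 r = R' r" if "r \<notin> {73..79}" for r
        using that 1(2)[of r] writes_eval_progs(4) by blast
      have "wp update_prog (\<lambda>t' R' M'. t' \<le> 20 \<and> R' 72 = Suc k * W \<and>
         (R' 60, R' 61, R' 62) = dp.choose_page v s t (Suc k) \<and> M' = M1) R2 M1"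
      proof (rule wp_update_prog)
        show "regs1 R2" using r(1) by (simp add: fr2 regs1_def regs0_def)
      qed (use 1 9 r mem M1 st in \<open>auto simp: fr2\<close>)
      then show ?case using 1 by (auto elim!: wp_mono)
    qed
  qed (use R R1 in \<open>auto simp: eval_defs regs1_def regs0_def\<close>)
  show ?thesis
    unfolding eval_prog_def wp_Seq
  proof (rule wp_use[OF wp_decode_prog[OF R(1,2) st(1) M(2)]], goal_cases)
    case (1 t1 R1 M1)
    have "R1 rC = c" using 1(2)[of rC] R(1) by (auto simp: eval_defs regs1_def)
    \<comment> \<open>Checking all \<open>W\<close> types on each of the \<open>c\<close> pages
      costs \<open>21 * D\<close>; with the \<open>14 * D\<close> of decoding this gives the
      35.\<close>
    moreover have "c * ((24 + W * 21) + 4) = c * 28 + D * 21" by (simp add: D_def algebra_simps)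
    moreover have "bits_mem s M1" "\<And>a. a < aBits \<or> aPow \<le> a \<Longrightarrow> M1 a = M a" using 1(1) by blast+
    note loop[OF 1(2) this]
    ultimately show ?case using 1(1)
      by (auto elim!: wp_mono)
  qed
qed

end

section \<open>Filling the table and reading off the pages\<close>

definition item_prog :: prog where
  "item_prog =
     Add 94 rOrd 93 ;; Load 94 94 ;; Add 51 rLft 94 ;; Load 51 51 ;;
     Add 52 rRgt 94 ;; Load 52 52 ;; Add 53 rTy 94 ;; Load 53 53"

text \<open>Register 50, the current state, is at the same time the counter of the loop over all
  states. The result goes one row further, to the row after the one being read.\<close>

definition state_body :: prog where
  "state_body = eval_prog ;; Add 96 54 rB ;; Add 96 96 50 ;; Store 96 60"

definition fill_body :: prog where
  "fill_body =
     Imm 92 1 ;; Sub 93 rM 90 ;; Sub 93 93 92 ;; item_prog ;;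
     For 50 95 rB state_body ;; Add 54 54 rB"

definition fill_prog :: prog where
  "fill_prog = Move 54 rVal ;; For 90 91 rM fill_body"

text \<open>Pages are written over the input, in the cells below \<open>m\<close>. This is safe
  because the items are by now read only from the arrays from \<open>aTy\<close> on.\<close>

definition out_body :: prog where
  "out_body = Sub 54 54 rB ;; item_prog ;; eval_prog ;; Store 94 61 ;; Move 50 62"

definition out_prog :: prog where
  "out_prog = Imm 50 0 ;; For 93 91 rM out_body"

context ordered_graph
begin

definition table_mem :: "(nat \<Rightarrow> nat) \<Rightarrow> bool" where
  "table_mem M \<longleftrightarrow> edge_mem M \<and> ord_mem M \<and> rep_mem M \<and> pow_mem M"

lemma table_mem_cong:
  assumes "table_mem M" "\<And>a. aTy \<le> a \<and> a < aBits \<or> aPow \<le> a \<and> a < aVal \<Longrightarrow> M' a = M a"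
  shows "table_mem M'"
proof -
  have "aTy \<le> aLft" "aLft \<le> aRgt" "aRgt \<le> aOrd" "aOrd \<le> aSlot" "aSlot \<le> aLo" "aLo \<le> aHi"
    by (simp_all add: aLft_def aRgt_def aOrd_def aSlot_def aLo_def aHi_def)
  then show ?thesis
    using assms unfolding table_mem_def edge_mem_def ord_mem_def rep_mem_def pow_mem_def
    by (auto simp: addr_defs)
qed

abbreviation B :: nat where "B \<equiv> 2 ^ D"

definition eval_time :: nat where "eval_time = 13 + D * 35 + c * 28"

lemma wp_item_prog:
  assumes "regs1 R" "table_mem M" "R 93 = t" "t < m"
  shows "wp item_prog (\<lambda>t' R' M'. t' = 8 \<and> M' = M \<and> R' 94 = item t \<and> R' 51 = lft (item t) \<and>
    R' 52 = rgt (item t) \<and> R' 53 = ty (item t)) R M"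
  unfolding item_prog_def using assms item_less[of t]
  by (simp add: regs1_def regs0_def table_mem_def ord_mem_def edge_mem_def)

text \<open>All results go to cells from \<open>row + B\<close> on, so the row \<open>v\<close>
  stays readable for every state.\<close>

lemma wp_row:
  assumes R: "regs1 R" "R rB = B" "R 51 = lft (item t)" "R 52 = rgt (item t)" "R 53 = ty (item t)" "R 54 = row"
    and M: "table_mem M" "aVal \<le> row" "\<forall>s<B. M (row + s) = v s" and t: "t < m"
  shows "wp (For 50 95 rB state_body) (\<lambda>t' R' M'. t' \<le> 3 + B * (7 + eval_time) \<and>
     (\<forall>s<B. M' (row + B + s) = fst (dp.choose_page v s t c)) \<and>
     (\<forall>a. a < aBits \<or> aPow \<le> a \<and> a < row + B \<longrightarrow> M' a = M a)) R M"
proof -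
  define P where "P k M' \<longleftrightarrow> (\<forall>s<k. M' (row + B + s) = fst (dp.choose_page v s t c)) \<and>
     (\<forall>a. a < aBits \<or> aPow \<le> a \<and> a < row + B \<longrightarrow> M' a = M a)" for k M'
  have "wp (For 50 95 rB state_body) (\<lambda>t' R' M'. t' \<le> 3 + B * ((eval_time + 3) + 4) \<and> P B M') R M"
  proof (rule wp_For[where Inv = "\<lambda>k R' M'. P k M'"], goal_cases)
    case (9 k R' M')
    have w: "writes state_body \<subseteq> {60..96} - {90..95}"
      using writes_eval_progs(1) by (force simp: state_body_def)
    have fr: "R' r = R r" if "r \<notin> {50, 95} \<union> {60..96}" for r
    proof -
      have "r \<notin> {50, 95} \<union> writes state_body" using w that by auto
      then show ?thesis using 9(4) by blast
    qed
    have r: "regs1 R'" "R' 50 = k" "R' 51 = lft (item t)" "R' 52 = rgt (item t)" "R' 53 = ty (item t)"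
       "R' 54 = row" "R' rB = B"
      using R 9(2) by (simp_all add: fr regs1_def regs0_def)
    have old: "M' a = M a" if "a < aBits \<or> aPow \<le> a \<and> a < row + B" for a
      using 9(3) that unfolding P_def by blast
    have "table_mem M'" using M(2) by (intro table_mem_cong[OF M(1)] old) auto
    moreover have "M' (row + s) = v s" if "s < B" for s
    proof -
      have "aPow \<le> row + s" using M(2) by (simp add: aVal_def)
      then show ?thesis using old[of "row + s"] M(3) that by simp
    qed
    ultimately have ev: "wp eval_prog (\<lambda>t' R'' M''. t' \<le> 13 + D * 35 + c * 28 \<and>
       (R'' 60, R'' 61, R'' 62) = dp.choose_page v k t c \<and>
       (\<forall>a. a < aBits \<or> aPow \<le> a \<longrightarrow> M'' a = M' a)) R' M'"
      using M(2) 9(1) t r by (intro wp_eval_prog) (auto simp: table_mem_def)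
    show ?case
      unfolding state_body_def
    proof (rule wp_SeqI[OF ev], goal_cases)
      case (1 t1 R1 M1)
      have fr1: "R1 r = R' r" if "r \<notin> {60..88}" for r
        using 1(2)[of r] writes_eval_progs(1) that by blast
      have r1: "R1 54 = row" "R1 rB = B" "R1 50 = k" "R1 60 = fst (dp.choose_page v k t c)"
        using r 1(1) by (simp_all add: fr1) (metis fst_conv)
      have eq: "M1 a = M' a" if "a < aBits \<or> aPow \<le> a" for a using 1(1) that by blast
      have up: "aPow \<le> row" using M(2) by (simp add: aVal_def)
      have lo: "aBits \<le> aPow" by (simp add: aPow_def)
      have "P (Suc k) (M1(row + B + k := fst (dp.choose_page v k t c)))"
        unfolding P_def
      proof (intro conjI allI impI, goal_cases)
        case (1 s)
        then show ?case using eq[of "row + B + s"] up 9(3) by (cases "s = k") (auto simp: P_def less_Suc_eq)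
      next
        case (2 a)
        then show ?case using eq[of a] old[of a] up lo by auto
      qed
      then show ?case using 1(1) by (simp add: r1 eval_time_def add.assoc)
    qed
  qed (use R writes_eval_progs(1) in \<open>auto simp: state_body_def P_def\<close>)
  then show ?thesis by (auto elim!: wp_mono simp: P_def)
qed

definition cost_mem :: "nat \<Rightarrow> (nat \<Rightarrow> nat) \<Rightarrow> bool" where
  "cost_mem k M \<longleftrightarrow> (\<forall>j\<le>k. \<forall>s<B. M (aVal + j * B + s) = dp.cost j s)"

text \<open>Row 0 need not be written: \<open>cost 0\<close> is constantly 0, and so is the
  untouched memory from \<open>aVal\<close> on.\<close>

lemma wp_fill_prog:
  assumes R: "regs1 R" "R rB = B" and M: "table_mem M" "\<forall>a\<ge>aVal. M a = 0"
  shows "wp fill_prog (\<lambda>t' R' M'. t' \<le> 4 + m * (19 + B * (7 + eval_time)) \<and> R' 54 = aVal + m * B \<and>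
     table_mem M' \<and> cost_mem m M') R M"
proof -
  have ws: "writes state_body \<subseteq> {60..88} \<union> {96}" using writes_eval_progs(1) by (auto simp: state_body_def)
  have w: "writes fill_body \<subseteq> {50..54} \<union> {60..88} \<union> {92..96}"
    using ws by (auto simp: fill_body_def item_prog_def)
  define P where "P k M' \<longleftrightarrow> table_mem M' \<and> cost_mem k M'" for k M'
  have "wp (For 90 91 rM fill_body) (\<lambda>t' R' M'. t' \<le> 3 + m * ((15 + B * (7 + eval_time)) + 4) \<and>
      (R' 54 = aVal + m * B \<and> P m M')) (R(54 := aVal)) M"
  proof (rule wp_For[where Inv = "\<lambda>k R' M'. R' 54 = aVal + k * B \<and> P k M'"], goal_cases)
    case (9 k R' M')
    let ?t = "m - Suc k" and ?row = "aVal + k * B"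
    have fr: "R' r = R r" if "r < 50" for r
      using 9(4)[of r] w that by (auto dest!: subsetD)
    have r: "regs1 R'" "R' rB = B" "R' 54 = ?row" "R' 90 = k" "R' (Suc 0) = m"
      using R 9(2,3) by (simp_all add: fr regs1_def regs0_def)
    have t: "?t < m" using 9(1) by simp
    have tm: "table_mem M'" and cm: "cost_mem k M'" using 9(3) by (auto simp: P_def)
    let ?R = "R'(92 := 1, 93 := ?t)"
    have it: "wp item_prog (\<lambda>t' R'' M''. t' = 8 \<and> M'' = M' \<and> R'' 94 = item ?t \<and> R'' 51 = lft (item ?t) \<and>
       R'' 52 = rgt (item ?t) \<and> R'' 53 = ty (item ?t)) ?R M'"
      by (rule wp_item_prog) (use r tm t in \<open>auto simp: regs1_def regs0_def\<close>)
    have "wp (item_prog ;; For 50 95 rB state_body ;; Add 54 54 rB)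
      (\<lambda>t' R'' M''. 3 + t' \<le> 15 + B * (7 + eval_time) \<and> R'' 54 = aVal + Suc k * B \<and> P (Suc k) M'') ?R M'"
    proof (rule wp_SeqI[OF it], goal_cases)
      case (1 t1 R1 M1)
      have fr1: "R1 r = ?R r" if "r \<notin> {51..53} \<union> {94}" for r
        using 1(2)[of r] that by (auto simp: item_prog_def)
      have r1: "regs1 R1" "R1 rB = B" "R1 54 = ?row"
        using r by (simp_all add: fr1 regs1_def regs0_def)
      have M1: "M1 = M'" using 1(1) by simp
      have v: "\<forall>s<B. M1 (?row + s) = dp.cost k s" using cm M1 by (auto simp: cost_mem_def)
      have tm1: "table_mem M1" using tm M1 by simp
      have row: "aVal \<le> ?row" by simp
      have it1: "R1 51 = lft (item ?t)" "R1 52 = rgt (item ?t)" "R1 53 = ty (item ?t)" using 1(1) by auto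
      note rw = wp_row[OF r1(1,2) it1 r1(3) tm1 row v t]
      show ?case
      proof (rule wp_SeqI[OF rw], goal_cases)
        case 2: (1 t2 R2 M2)
        have r2: "R2 54 = ?row" "R2 rB = B"
        proof -
          have "54 \<notin> writes (For 50 95 rB state_body)" "rB \<notin> writes (For 50 95 rB state_body)"
            using ws by auto
          then show "R2 54 = ?row" "R2 rB = B" using 2(2) r1 by metis+
        qed
        have eq: "M2 a = M1 a" if "a < aBits \<or> aPow \<le> a \<and> a < ?row + B" for a using 2(1) that by blast
        have "table_mem M2" by (rule table_mem_cong[OF tm1]) (auto intro!: eq)
        moreover have "M2 (aVal + j * B + s) = dp.cost j s" if j: "j \<le> Suc k" and s: "s < B" for j s
        proof (cases "j = Suc k")
          case True
          have "M2 (?row + B + s) = fst (dp.choose_page (dp.cost k) s ?t c)" using 2(1) s by blast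
          then show ?thesis using True by (simp add: algebra_simps)
        next
          case False
          then have "j * B \<le> k * B" using j by (intro mult_le_mono1) simp
          then have "aVal + j * B + s < ?row + B" using s by linarith
          moreover have "aPow \<le> aVal + j * B + s" by (simp add: aVal_def)
          ultimately
          have "M2 (aVal + j * B + s) = M1 (aVal + j * B + s)" by (intro eq) simp
          then show ?thesis using cm M1 False j s by (simp add: cost_mem_def)
        qed
        ultimately have "P (Suc k) M2" by (simp add: P_def cost_mem_def)
        then show ?case using 1(1) 2(1) by (simp add: r2)
      qed
    qed
    then show ?case
      unfolding fill_body_def by (simp add: r)
  qed (use R w M in \<open>auto simp: regs1_def regs0_def P_def cost_mem_def dest!: subsetD\<close>)
  then show ?thesis
    unfolding fill_prog_def using R by (auto elim!: wp_mono simp: regs1_def P_def)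
qed

text \<open>Giving each edge the page numbered by the rank of its target is admissible: edges on a
  common page share an end and cannot cross.\<close>

lemma cost_le_c: "dp.cost m 0 \<le> c"
proof -
  let ?f = "\<lambda>t. cnt (tgt (item t))"
  have lt: "?f t < c" if "t < m" for t using that cnt_less src_tgt(3) item_less by blast
  have "dp.noncrossing ?f"
    unfolding dp.noncrossing_def
  proof (intro allI impI)
    fix t a assume "t < m" "a < t" "?f a = ?f t"
    then have "tgt (item a) = tgt (item t)" using cnt_inject src_tgt(3) item_less by (metis less_trans)
    then show "\<not> crosses (lft (item a)) (rgt (item a)) (lft (item t)) (rgt (item t))"
      by (auto simp: crosses_def lft_def rgt_def)
  qed
  then show ?thesis using dp.cost_le[of ?f c m] lt by simp
qed

lemma wp_out_prog:
  assumes R: "regs1 R" "R rB = B" "R 54 = aVal + m * B" and M: "table_mem M" "cost_mem m M"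
  shows "wp out_prog (\<lambda>t' R' M'. t' \<le> 4 + m * (15 + eval_time) \<and> (\<forall>t<m. M' (item t) = dp.page_of t)) R M"
proof -
  have w: "writes out_body \<subseteq> {50..54} \<union> {60..88} \<union> {94}"
    using writes_eval_progs(1) by (auto simp: out_body_def item_prog_def)
  define P where "P k M' \<longleftrightarrow> (\<forall>t<k. M' (item t) = dp.page_of t) \<and>
     (\<forall>a. aTy \<le> a \<and> a < aBits \<or> aPow \<le> a \<longrightarrow> M' a = M a)" for k M'
  have "wp (For 93 91 rM out_body) (\<lambda>t' R' M'. t' \<le> 3 + m * ((eval_time + 11) + 4) \<and>
      (R' 54 = aVal + (m - m) * B \<and> R' 50 = dp.greedy m \<and> P m M')) (R(50 := 0)) M"
  proof (rule wp_For[where Inv = "\<lambda>k R' M'. R' 54 = aVal + (m - k) * B \<and> R' 50 = dp.greedy k \<and> P k M'"],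
      goal_cases)
    case (9 k R' M')
    let ?row = "aVal + (m - Suc k) * B"
    have fr: "R' r = R r" if "r < 50" for r
      using 9(4)[of r] w that by (auto dest!: subsetD)
    have "m - k = Suc (m - Suc k)" using 9(1) by simp
    then have r: "regs1 R'" "R' rB = B" "R' 54 = ?row + B" "R' 93 = k" "R' 50 = dp.greedy k"
      using R 9(2,3) by (simp_all add: fr regs1_def regs0_def)
    have old: "M' a = M a" if "aTy \<le> a \<and> a < aBits \<or> aPow \<le> a" for a
      using 9(3) that unfolding P_def by blast
    have tm: "table_mem M'" by (rule table_mem_cong[OF M(1)]) (auto intro!: old)
    have v: "M' (?row + s) = dp.cost (m - Suc k) s" if "s < B" for s
      using M(2) that old[of "?row + s"] by (simp add: cost_mem_def aVal_def)
    let ?R = "R'(54 := ?row)"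
    have it: "wp item_prog (\<lambda>t' R'' M''. t' = 8 \<and> M'' = M' \<and> R'' 94 = item k \<and> R'' 51 = lft (item k) \<and>
       R'' 52 = rgt (item k) \<and> R'' 53 = ty (item k)) ?R M'"
      by (rule wp_item_prog) (use r tm 9(1) in \<open>auto simp: regs1_def regs0_def\<close>)
    have "wp (item_prog ;; eval_prog ;; Store 94 61 ;; Move 50 62)
      (\<lambda>t' R'' M''. 1 + t' \<le> eval_time + 11 \<and> R'' 54 = ?row \<and> R'' 50 = dp.greedy (Suc k) \<and> P (Suc k) M'') ?R M'"
    proof (rule wp_SeqI[OF it], goal_cases)
      case (1 t1 R1 M1)
      have fr1: "R1 r = ?R r" if "r \<notin> {51..53} \<union> {94}" for r
        using 1(2)[of r] that by (auto simp: item_prog_def)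
      have r1: "regs1 R1" "R1 50 = dp.greedy k" "R1 54 = ?row"
        using r by (simp_all add: fr1 regs1_def regs0_def)
      have M1: "M1 = M'" using 1(1) by simp
      have ev: "wp eval_prog (\<lambda>t' R'' M''. t' \<le> 13 + D * 35 + c * 28 \<and>
         (R'' 60, R'' 61, R'' 62) = dp.choose_page (dp.cost (m - Suc k)) (dp.greedy k) k c \<and>
         (\<forall>a. a < aBits \<or> aPow \<le> a \<longrightarrow> M'' a = M1 a)) R1 M1"
        using r1 1(1) M1 tm v 9(1) dp.greedy_less[OF cost_le_c, of k]
        by (intro wp_eval_prog) (auto simp: table_mem_def D_def)
      show ?case
      proof (rule wp_SeqI[OF ev], goal_cases)
        case (1 t2 R2 M2)
        have r2: "R2 54 = ?row" "R2 94 = item k"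
        proof -
          have "54 \<notin> writes eval_prog" "94 \<notin> writes eval_prog" using writes_eval_progs(1) by auto
          then show "R2 54 = ?row" "R2 94 = item k" using 1(2) r1 \<open>t1 = 8 \<and> _\<close> by metis+
        qed
        have r3: "R2 61 = dp.page_of k" "R2 62 = dp.greedy (Suc k)"
          using 1(1) by (simp_all add: dp.page_of_def) (metis fst_conv snd_conv)+
        have eq: "M2 a = M1 a" if "a < aBits \<or> aPow \<le> a" for a using 1(1) that by blast
        have le: "m \<le> aTy" "aTy \<le> aBits" by (simp_all add: addr_defs aMark_def)
        have ik: "item k < m" using item_less 9(1) by simp
        have "P (Suc k) (M2(item k := dp.page_of k))"
          unfolding P_def
        proof (intro conjI allI impI, goal_cases)
          case (1 t)
          show ?case
          proof (cases "t = k")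
            case False
            then have t: "t < k" using 1 by simp
            then have "item t \<noteq> item k" using item_key[OF _ 9(1), of t] by auto
            moreover have "item t < aBits" using item_less[of t] t 9(1) le by simp
            ultimately show ?thesis using eq[of "item t"] 9(3) t M1 by (simp add: P_def)
          qed simp
        next
          case (2 a)
          then show ?case using eq[of a] old[of a] ik le M1 by (auto simp: aPow_def)
        qed
        then show ?case using 1(1) \<open>t1 = 8 \<and> _\<close> by (simp add: r2 r3 eval_time_def del: dp.greedy.simps)
      qed
    qed
    then show ?case
      unfolding out_body_def by (simp add: r del: dp.greedy.simps)
  qed (use R w M in \<open>auto simp: regs1_def regs0_def P_def dest!: subsetD\<close>)
  then show ?thesis
    unfolding out_prog_def by (auto elim!: wp_mono simp: P_def)
qed

end

section \<open>The whole program\<close>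

definition base_prog :: prog where
  "base_prog =
     Add rMark rN rM ;; Add rMark rMark rM ;; Add rPos rMark rN ;; Add rRow rPos rN ;;
     Add rCls rRow rN ;; Add rCnt rCls rN ;; Add rTy rCnt rN ;; Add rLft rTy rM ;;
     Add rRgt rLft rM ;; Add rOrd rRgt rM ;; Add rSlot rOrd rM"

definition size_prog :: prog where
  "size_prog =
     Add rC2 rC rC ;; Mul rS rC2 rN 30 39 ;; Imm 40 1 ;; Add 40 40 rC2 ;;
     Mul rW 40 rC 30 39 ;; Mul rD rW rC 30 39 ;;
     Add rLo rSlot rS ;; Add rHi rLo rW ;; Add rBits rHi rW ;; Add rPow rBits rD ;; Add rVal rPow rD"

definition solve_prog :: prog where
  "solve_prog =
     base_prog ;; mark_prog ;; size_prog ;; scan_prog ;; edges_prog ;; sort_prog ;; rep_prog ;;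
     pow_prog ;; fill_prog ;; out_prog"

lemma writes_progs:
  "writes mark_prog \<subseteq> {2} \<union> {30..49}" "writes scan_prog \<subseteq> {30..49}" "writes edges_prog \<subseteq> {30..49}"
  "writes sort_prog \<subseteq> {30..49}" "writes rep_prog \<subseteq> {30..49}" "writes pow_prog \<subseteq> {20} \<union> {30..49}"
  "writes fill_prog \<subseteq> {50..99}"
proof -
  show "writes fill_prog \<subseteq> {50..99}"
    using writes_eval_progs(1) by (auto simp: fill_prog_def fill_body_def item_prog_def state_body_def)
qed (auto simp: mark_prog_def mark_body_def scan_prog_def scan_body_def edges_prog_def edges_body_def
    sort_prog_def sort_body_def rep_prog_def rep_body_def pow_prog_def)

context ordered_graph
begin

lemma regs0_cong: "regs0 R \<Longrightarrow> (\<And>r. r < 30 \<Longrightarrow> r \<noteq> rC \<Longrightarrow> R' r = R r) \<Longrightarrow> regs0 R'"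
  by (simp add: regs0_def)

lemma regs1_cong: "regs1 R \<Longrightarrow> (\<And>r. r < 30 \<Longrightarrow> r \<noteq> rB \<Longrightarrow> R' r = R r) \<Longrightarrow> regs1 R'"
  by (simp add: regs1_def regs0_def)

lemma wp_base_prog:
  assumes "R rN = n" "R rM = m"
  shows "wp base_prog (\<lambda>t R' M'. t = 11 \<and> regs0 R' \<and> M' = M) R M"
  unfolding base_prog_def using assms
  by (simp add: regs0_def addr_defs aMark_def)

lemma wp_size_prog:
  assumes R: "regs0 R" "R rC = c"
  shows "wp size_prog (\<lambda>t R' M'. t \<le> 20 + 5 * n + 10 * c \<and> regs1 R' \<and> M' = M) R M"
proof -
  have mul: "wp (Mul d a b 30 39) (\<lambda>t R' M'. t \<le> 4 + y * 5 \<and> R' d = x * y \<and> M' = M \<and>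
      (\<forall>r. r \<notin> {d, 30, 39} \<longrightarrow> R' r = R r)) R M"
    if "R a = x" "R b = y" "distinct [d, a, 30, 39]" "distinct [d, b, 30, 39]" for d a b x y R M
    by (rule wp_use[OF wp_Mul[OF that(3,4)]]) (use that(1,2) in auto)
  let ?R0 = "R(rC2 := 2 * c)"
  have m1: "wp (Mul rS rC2 rN 30 39) (\<lambda>t R' M'. t \<le> 4 + n * 5 \<and> R' rS = 2 * c * n \<and> M' = M \<and>
      (\<forall>r. r \<notin> {rS, 30, 39} \<longrightarrow> R' r = ?R0 r)) ?R0 M"
    by (rule mul) (use R in \<open>auto simp: regs0_def\<close>)
  have "wp (Mul rS rC2 rN 30 39 ;; Imm 40 1 ;; Add 40 40 rC2 ;;
     Mul rW 40 rC 30 39 ;; Mul rD rW rC 30 39 ;;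
     Add rLo rSlot rS ;; Add rHi rLo rW ;; Add rBits rHi rW ;; Add rPow rBits rD ;; Add rVal rPow rD)
     (\<lambda>t R' M'. 1 + t \<le> 20 + 5 * n + 10 * c \<and> regs1 R' \<and> M' = M) ?R0 M"
  proof (rule wp_SeqI[OF m1], goal_cases)
    case (1 t1 R1 M1)
    let ?R1 = "R1(40 := 2 * c + 1)"
    have r1: "R1 rC2 = 2 * c" "R1 rC = c" using 1(1) R by auto
    have m2: "wp (Mul rW 40 rC 30 39) (\<lambda>t R' M'. t \<le> 4 + c * 5 \<and> R' rW = (2 * c + 1) * c \<and> M' = M1 \<and>
      (\<forall>r. r \<notin> {rW, 30, 39} \<longrightarrow> R' r = ?R1 r)) ?R1 M1"
      by (rule mul) (use r1 in auto)
    have "wp (Mul rW 40 rC 30 39 ;; Mul rD rW rC 30 39 ;;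
       Add rLo rSlot rS ;; Add rHi rLo rW ;; Add rBits rHi rW ;; Add rPow rBits rD ;; Add rVal rPow rD)
       (\<lambda>t R' M'. 1 + (t1 + (2 + t)) \<le> 20 + 5 * n + 10 * c \<and> regs1 R' \<and> M' = M) ?R1 M1"
    proof (rule wp_SeqI[OF m2], goal_cases)
      case 2: (1 t2 R2 M2)
      have r2: "R2 rW = W" "R2 rC = c" using 2(1) r1 by (auto simp: W_def)
      have m3: "wp (Mul rD rW rC 30 39) (\<lambda>t R' M'. t \<le> 4 + c * 5 \<and> R' rD = W * c \<and> M' = M2 \<and>
         (\<forall>r. r \<notin> {rD, 30, 39} \<longrightarrow> R' r = R2 r)) R2 M2"
        by (rule mul) (use r2 in auto)
      show ?case
      proof (rule wp_SeqI[OF m3], goal_cases)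
        case 3: (1 t3 R3 M3)
        have fr: "R3 r = R r" if "r < 13" for r
          using 1(1) 2(1) 3(1) that by simp
        have "regs0 R3" "R3 rC = c" using R by (simp_all add: regs0_def fr)
        moreover have "R3 rW = W" "R3 rD = D" "R3 rS = 2 * c * n" "R3 rC2 = 2 * c"
          using 1(1) 2(1) 3(1) r1 r2 by (simp_all add: D_def)
        ultimately show ?case using 1(1) 2(1) 3(1)
          by (simp add: regs1_def regs0_def aLo_def aHi_def aBits_def aPow_def aVal_def)
      qed
    qed
    then show ?case using r1 by simp
  qed
  then show ?thesis
    unfolding size_prog_def using R(2) by (simp add: mult_2)
qed

definition total_time :: nat where
  "total_time = 11 + (5 + m * 19) + (20 + 5 * n + 10 * c) + (6 + n * 22) + (4 + m * 42) +
     (4 + 2 * c * n * 12) + (3 + m * 19) + (4 + D * 7) + (4 + m * (19 + B * (7 + eval_time))) +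
     (4 + m * (15 + eval_time))"

lemma wp_solve_prog:
  assumes R: "R rN = n" "R rM = m" and M: "input_mem M" "\<forall>a\<ge>aMark. M a = 0"
  shows "wp solve_prog (\<lambda>t' R' M'. t' \<le> total_time \<and> (\<forall>t<m. M' (item t) = dp.page_of t)) R M"
  unfolding solve_prog_def
proof (rule wp_SeqI[OF wp_base_prog[OF R, of M]], goal_cases)
  case (1 t1 R1 M1)
  then have R1: "regs0 R1" and M1: "M1 = M" and t1: "t1 = 11" by auto
  show ?case unfolding M1
  proof (rule wp_SeqI[OF wp_mark_prog[OF R1 M]], goal_cases)
    case (1 t2 R2 M2)
    have "regs0 R2" using writes_progs(1) by (intro regs0_cong[OF R1] 1(2)) (auto dest: subsetD)
    then have R2: "regs0 R2" "R2 rC = c" using 1(1) by auto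
    have M2: "mark_mem M2" "\<forall>a\<ge>aTy. M2 a = 0" "input_mem M2"
      using 1(1) M by (auto simp: input_mem_def addr_defs aMark_def)
    note t2 = 1(1)
    show ?case
    proof (rule wp_SeqI[OF wp_size_prog[OF R2, of M2]], goal_cases)
      case (1 t3 R3 M3)
      then have R3: "regs1 R3" and M3: "M3 = M2" by auto
      note t3 = 1(1)
      show ?case unfolding M3
      proof (rule wp_SeqI[OF wp_scan_prog[OF R3 M2(3,1)]], goal_cases)
        case (1 t4 R4 M4)
        have R4: "regs1 R4" using writes_progs(2) by (intro regs1_cong[OF R3] 1(2)) (auto dest: subsetD)
        have M4: "input_mem M4" "mark_mem M4" "vert_mem M4" "\<forall>a\<ge>aTy. M4 a = 0"
          using 1(1) M2 by (auto simp: input_mem_def mark_mem_def addr_defs aMark_def)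
        note t4 = 1(1)
        show ?case
        proof (rule wp_SeqI[OF wp_edges_prog[OF R4 M4]], goal_cases)
          case (1 t5 R5 M5)
          have R5: "regs1 R5" using writes_progs(3) by (intro regs1_cong[OF R4] 1(2)) (auto dest: subsetD)
          have M5: "edge_mem M5" "slot_mem M5" "\<forall>a\<ge>aLo. M5 a = 0"
            using 1(1) M4(4) by (auto simp: addr_defs)
          note t5 = 1(1)
          show ?case
          proof (rule wp_SeqI[OF wp_sort_prog[OF R5 M5(2)]], goal_cases)
            case (1 t6 R6 M6)
            have R6: "regs1 R6" using writes_progs(4) by (intro regs1_cong[OF R5] 1(2)) (auto dest: subsetD)
            have M6: "edge_mem M6" "ord_mem M6" "\<forall>a\<ge>aLo. M6 a = 0"
              using 1(1) M5 by (auto simp: edge_mem_def addr_defs)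
            note t6 = 1(1)
            show ?case
            proof (rule wp_SeqI[OF wp_rep_prog[OF R6 M6]], goal_cases)
              case (1 t7 R7 M7)
              have R7: "regs1 R7" using writes_progs(5) by (intro regs1_cong[OF R6] 1(2)) (auto dest: subsetD)
              have M7: "edge_mem M7" "ord_mem M7" "rep_mem M7" "\<forall>a\<ge>aVal. M7 a = 0"
                using 1(1) M6 by (auto simp: edge_mem_def ord_mem_def addr_defs)
              note t7 = 1(1)
              show ?case
              proof (rule wp_SeqI[OF wp_pow_prog[OF R7, of M7]], goal_cases)
                case (1 t8 R8 M8)
                have "regs1 R8" using writes_progs(6) by (intro regs1_cong[OF R7] 1(2)) (auto dest: subsetD)
                then have R8: "regs1 R8" "R8 rB = B" using 1(1) by auto
                have M8: "table_mem M8" "\<forall>a\<ge>aVal. M8 a = 0"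
                  using 1(1) M7 by (auto simp: table_mem_def edge_mem_def ord_mem_def rep_mem_def addr_defs)
                note t8 = 1(1)
                show ?case
                proof (rule wp_SeqI[OF wp_fill_prog[OF R8 M8]], goal_cases)
                  case (1 t9 R9 M9)
                  have R9: "regs1 R9" using writes_progs(7) by (intro regs1_cong[OF R8(1)] 1(2)) (auto dest: subsetD)
                  have "rB \<notin> writes fill_prog" using writes_progs(7) by auto
                  then have B9: "R9 rB = B" using 1(2) R8(2) by metis
                  note t9 = 1(1)
                  have "wp out_prog (\<lambda>t' R' M'. t' \<le> 4 + m * (15 + eval_time) \<and>
                    (\<forall>t<m. M' (item t) = dp.page_of t)) R9 M9"
                    using 1(1) R9 B9 by (intro wp_out_prog) auto
                  then show ?case
                    by (rule wp_mono) (use t1 t2 t3 t4 t5 t6 t7 t8 t9 in \<open>auto simp: total_time_def\<close>)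
                qed
              qed
            qed
          qed
        qed
      qed
    qed
  qed
qed

end

section \<open>Running time and correctness\<close>

context ordered_graph
begin

section \<open>The time bound\<close>

text \<open>Comes for free from the keys, which inject the edges into \<open>2 * c * n\<close>
  values.\<close>

lemma m_le: "m \<le> 2 * c * n"
proof -
  have "inj_on key {..<m}" using key_inject by (auto simp: inj_on_def)
  moreover have "key ` {..<m} \<subseteq> {..<2 * c * n}" using key_less by auto
  ultimately have "card {..<m} \<le> card {..<2 * c * n}" by (metis card_inj_on_le finite_lessThan)
  then show ?thesis by simp
qed

text \<open>With \<open>u = c + 1\<close> the dominant term is \<open>m * B * eval_time\<close>, of
  order \<open>u * N\<close> times \<open>B\<close> times \<open>u ^ 3\<close>. All constants
  together stay below 1024, which is the 10 in the exponent, and \<open>u \<le> 2 ^ c\<close> turns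
  \<open>u ^ 4\<close> into \<open>4 * c\<close>. The factor \<open>max 1 n\<close> pays for the
  constant number of steps on the empty graph.\<close>

lemma total_time_le: "total_time \<le> 2 ^ (10 + 4 * c + (2 * c + 1) * c * c) * max 1 n"
proof -
  define u N where "u = c + 1" and "N = max 1 n"
  let ?Z = "u ^ 4 * N * B"
  have u: "1 \<le> u" "c \<le> u" and N: "1 \<le> N" "n \<le> N" by (auto simp: u_def N_def)
  have up: "u \<le> u ^ 3" "1 \<le> u ^ 3" "u ^ 3 \<le> u ^ 4" "u \<le> u ^ 4" "1 \<le> u ^ 4"
    using u(1) self_le_power[of u 3] self_le_power[of u 4] power_increasing[of 3 4 u] by auto
  have D: "D \<le> 2 * u ^ 3"
  proof -
    have "D = (2 * c + 1) * (c * c)" by (simp add: D_def W_def algebra_simps)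
    also have "\<dots> \<le> (2 * u) * (u * u)" using u by (intro mult_le_mono) (auto simp: u_def)
    finally show ?thesis by (simp add: power3_eq_cube)
  qed
  have ev: "eval_time \<le> 111 * u ^ 3"
    unfolding eval_time_def using D up u(2) by linarith
  have mu: "m \<le> 2 * (u * N)"
    using m_le mult_le_mono[OF u(2) N(2)] by simp
  have B: "1 \<le> B" by simp
  have Z: "x * y \<le> ?Z" if "x \<le> u ^ 4" "y \<le> N" for x y
  proof -
    have "x * y * 1 \<le> u ^ 4 * N * B" using that B by (intro mult_le_mono)
    then show ?thesis by simp
  qed
  have z: "1 \<le> ?Z" "c \<le> ?Z" "n \<le> ?Z" "c * n \<le> ?Z" "u * N \<le> ?Z" "u ^ 3 \<le> ?Z"
    using Z[of 1 1] Z[of c 1] Z[of 1 n] Z[of c n] Z[of u N] Z[of "u ^ 3" 1] up u N by auto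
  have big: "m * (B * (118 * u ^ 3)) \<le> 236 * ?Z"
  proof -
    have "m * (B * (118 * u ^ 3)) \<le> 2 * (u * N) * (B * (118 * u ^ 3))" by (rule mult_le_mono1[OF mu])
    also have "\<dots> = 236 * ?Z" by (simp add: power_numeral_reduce algebra_simps)
    finally show ?thesis .
  qed
  have a: "m * (19 + B * (7 + eval_time)) \<le> 38 * ?Z + 236 * ?Z"
  proof -
    have "B * (7 + eval_time) \<le> B * (118 * u ^ 3)" using ev up by (intro mult_le_mono2) linarith
    then have "m * (19 + B * (7 + eval_time)) \<le> m * (19 + B * (118 * u ^ 3))"
      by (intro mult_le_mono2) (rule add_left_mono)
    also have "\<dots> = m * 19 + m * (B * (118 * u ^ 3))" by (rule distrib_left)
    also have "m * 19 \<le> 38 * ?Z" using mu z(5) by linarith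
    finally show ?thesis using big by linarith
  qed
  have b: "m * (15 + eval_time) \<le> 30 * ?Z + 236 * ?Z"
  proof -
    have "1 * eval_time \<le> B * (118 * u ^ 3)" using ev B by (intro mult_le_mono) linarith+
    then have "m * (15 + eval_time) \<le> m * (15 + B * (118 * u ^ 3))" by (intro mult_le_mono2) simp
    also have "\<dots> = m * 15 + m * (B * (118 * u ^ 3))" by (rule distrib_left)
    also have "m * 15 \<le> 30 * ?Z" using mu z(5) by linarith
    finally show ?thesis using big by linarith
  qed
  have "total_time \<le> 1024 * ?Z"
    unfolding total_time_def using a b z D mu by linarith
  also have "\<dots> \<le> 1024 * ((2 ^ c) ^ 4 * N * B)"
  proof -
    have "u \<le> 2 ^ c" unfolding u_def Suc_eq_plus1[symmetric] by (rule Suc_leI[OF less_exp])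
    then show ?thesis by (intro mult_le_mono2 mult_le_mono1 power_mono) auto
  qed
  also have "\<dots> = 2 ^ (10 + 4 * c + D) * N"
    by (simp add: power_add power_mult mult.commute algebra_simps)
  finally show ?thesis by (simp add: N_def D_def W_def)
qed

section \<open>From intervals back to book embeddings\<close>

text \<open>\<open>crosses\<close> is symmetric in the two edges, whereas a forbidden pattern starts
  with a particular one; hence the two ways of matching \<open>{u, v}\<close> and
  \<open>{w, x}\<close> with the edges.\<close>

lemma crosses_edges_iff:
  assumes e: "e < m" "e' < m"
  shows "crosses (lft e) (rgt e) (lft e') (rgt e') \<longleftrightarrow>
    (\<exists>u v w x. ({u, v} = edge_of (es ! e) \<and> {w, x} = edge_of (es ! e') \<or>
        {u, v} = edge_of (es ! e') \<and> {w, x} = edge_of (es ! e)) \<and>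
      pos u < pos w \<and> pos w < pos v \<and> pos v < pos x)" (is "?l \<longleftrightarrow> ?r")
proof
  have ends: "\<exists>u v. {u, v} = edge_of (es ! e) \<and> lft e = pos u \<and> rgt e = pos v" if "e < m" for e
    unfolding src_tgt(6)[OF that] lft_def rgt_def min_def max_def by (auto simp: insert_commute)
  assume ?l
  moreover obtain u v where "{u, v} = edge_of (es ! e) \<and> lft e = pos u \<and> rgt e = pos v"
    using ends[OF e(1)] by blast
  moreover obtain w x where "{w, x} = edge_of (es ! e') \<and> lft e' = pos w \<and> rgt e' = pos x"
    using ends[OF e(2)] by blast
  ultimately show ?r unfolding crosses_def by metis
next
  have ends: "lft e = pos u \<and> rgt e = pos v" if "{u, v} = edge_of (es ! e)" "e < m" "pos u < pos v" for u v e
    using that src_tgt(6)[OF that(2)] by (auto simp: doubleton_eq_iff lft_def rgt_def)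
  assume ?r
  then obtain u v w x where uv: "{u, v} = edge_of (es ! e) \<and> {w, x} = edge_of (es ! e') \<or>
        {u, v} = edge_of (es ! e') \<and> {w, x} = edge_of (es ! e)"
    and lt: "pos u < pos w" "pos w < pos v" "pos v < pos x" by blast
  have lt': "pos u < pos v" "pos w < pos x" using lt by auto
  from uv show ?l
  proof
    assume a: "{u, v} = edge_of (es ! e) \<and> {w, x} = edge_of (es ! e')"
    then have "lft e = pos u" "rgt e = pos v" "lft e' = pos w" "rgt e' = pos x"
      using ends[of u v e] ends[of w x e'] e lt' by auto
    then show ?l using lt by (simp add: crosses_def)
  next
    assume a: "{u, v} = edge_of (es ! e') \<and> {w, x} = edge_of (es ! e)"
    then have "lft e' = pos u" "rgt e' = pos v" "lft e = pos w" "rgt e = pos x"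
      using ends[of u v e'] ends[of w x e] e lt' by auto
    then show ?l using lt by (simp add: crosses_def)
  qed
qed

end

lemma length_concat_pairs: "length (concat (map (\<lambda>(u, v). [u, v]) es)) = 2 * length es"
  by (induction es) auto

lemma nth_concat_pairs:
  "j < length es \<Longrightarrow> concat (map (\<lambda>(u, v). [u, v]) es) ! (2 * j) = fst (es ! j) \<and>
     concat (map (\<lambda>(u, v). [u, v]) es) ! Suc (2 * j) = snd (es ! j)"
proof (induction es arbitrary: j)
  case (Cons a es)
  then show ?case by (cases j) (auto split: prod.splits)
qed simp

theorem theorem1:
  "\<exists>(P :: prog) (g :: nat \<Rightarrow> real).
     g \<in> O(\<lambda>\<tau>. real \<tau> ^ 3) \<and>
     (\<forall>(n :: nat) (V :: nat set) (E :: nat set set) (r :: nat rel) vs es.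
        V = {..<n} \<and> fin_graph V E \<and> vertex_order V r \<and> presents vs es V E r \<longrightarrow>
        (\<exists>t s \<sigma>.
           exec P (init_state vs es) t s \<and>
           real t \<le> 2 powr g (vertex_cover_number V E) * real (max 1 n) \<and>
           outputs s es \<sigma> \<and>
           book_embedding (fobt V E r) V E r \<sigma>))"
proof -
  \<comment> \<open>The exponent of \<open>total_time_le\<close> with \<open>c\<close> replaced by
    its bound \<open>2 * \<tau>\<close>.\<close>
  let ?g = "\<lambda>\<tau>::nat. real (10 + 8 * \<tau> + (4 * \<tau> + 1) * (2 * \<tau>) * (2 * \<tau>))"
  show ?thesis
  proof (rule exI[of _ solve_prog], rule exI[of _ ?g], intro conjI allI impI)
    show "?g \<in> O(\<lambda>\<tau>. real \<tau> ^ 3)"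
    \<comment> \<open>The coefficients of the expanded exponent sum up: 10 + 8 + 16 + 4 =
      38.\<close>
    proof (rule bigoI[of _ 38], rule eventually_sequentiallyI[of 1])
      fix \<tau> :: nat assume t: "1 \<le> \<tau>"
      have "\<tau> \<le> \<tau> ^ 3" "\<tau> ^ 2 \<le> \<tau> ^ 3" "1 \<le> \<tau> ^ 3"
        using t self_le_power[of \<tau> 3] power_increasing[of 2 3 \<tau>] by auto
      moreover have "10 + 8 * \<tau> + (4 * \<tau> + 1) * (2 * \<tau>) * (2 * \<tau>) = 10 + 8 * \<tau> + 16 * \<tau> ^ 3 + 4 * \<tau> ^ 2"
        by (simp add: power3_eq_cube power2_eq_square algebra_simps)
      ultimately have "10 + 8 * \<tau> + (4 * \<tau> + 1) * (2 * \<tau>) * (2 * \<tau>) \<le> 38 * \<tau> ^ 3" by linarith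
      then have "?g \<tau> \<le> real (38 * \<tau> ^ 3)" by (rule of_nat_mono)
      then show "norm (?g \<tau>) \<le> 38 * norm (real \<tau> ^ 3)" by simp
    qed
    fix n :: nat and V :: "nat set" and E r vs es
    assume "V = {..<n} \<and> fin_graph V E \<and> vertex_order V r \<and> presents vs es V E r"
    then have V: "V = {..<n}" and G: "fin_graph V E" and r: "vertex_order V r"
      and p: "set vs = V" "distinct vs" "sorted_wrt (\<lambda>u v. (u, v) \<in> r) vs"
        "edge_of ` set es = E" "distinct (map edge_of es)"
      by (auto simp: presents_def)
    define m where "m = length es"
    have n: "n = length vs" using p(1,2) V distinct_card[of vs] by simp
    have inE: "edge_of (es ! j) \<in> E" if "j < m" for j using p(4) that m_def by auto
    interpret ordered_graph vs es n m
    proof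
      show "fst (es ! j) < n \<and> snd (es ! j) < n \<and> fst (es ! j) \<noteq> snd (es ! j)" if "j < m" for j
        using inE[OF that] G V by (cases "es ! j") (auto simp: fin_graph_def dest!: bspec split: if_splits)
    qed (use n m_def p V in auto)
    \<comment> \<open>Sortedness of \<open>vs\<close> gives one direction; the other follows because
      \<open>r\<close> is irreflexive and transitive.\<close>
    have rpos: "(u, v) \<in> r \<longleftrightarrow> u < n \<and> v < n \<and> pos u < pos v" for u v
    proof
      have irr: "irrefl r" "trans r" "r \<subseteq> V \<times> V"
        using r by (auto simp: vertex_order_def strict_linear_order_on_def)
      have less: "(u, v) \<in> r" if "u < n" "v < n" "pos u < pos v" for u v
        using p(3) pos that n by (metis sorted_wrt_nth_less)
      show "(u, v) \<in> r" if "u < n \<and> v < n \<and> pos u < pos v" using that less by blast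
      assume uv: "(u, v) \<in> r"
      then have b: "u < n" "v < n" using irr(3) V by auto
      have "\<not> pos v \<le> pos u"
      proof
        assume "pos v \<le> pos u"
        then have "u = v \<or> (v, u) \<in> r" using less b pos_inject by (metis le_neq_implies_less)
        then show False using uv irr(1,2) by (metis irreflD transD)
      qed
      then show "u < n \<and> v < n \<and> pos u < pos v" using b by simp
    qed
    obtain C where C: "vertex_cover V E C" "card C = vertex_cover_number V E"
      using vertex_cover_number_attained[OF G] by blast
    let ?\<tau> = "vertex_cover_number V E"
    have c\<tau>: "c \<le> 2 * ?\<tau>"
      unfolding C(2)[symmetric]
    proof (rule c_le)
      show "finite C" using C(1) V by (auto simp: vertex_cover_def intro: finite_subset)
      show "fst (es ! e) \<in> C \<or> snd (es ! e) \<in> C" if "e < m" for e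
        using C(1) inE[OF that] by (cases "es ! e") (auto simp: vertex_cover_def)
    qed
    let ?R = "(\<lambda>_. 0)(0 := n, 1 := m) :: nat \<Rightarrow> nat"
    obtain M where init: "init_state vs es = (?R, M)" and M: "input_mem M" "\<forall>a\<ge>aMark. M a = 0"
    proof -
      let ?xs = "vs @ concat (map (\<lambda>(u, v). [u, v]) es)"
      let ?M = "\<lambda>i. if i < length ?xs then ?xs ! i else 0"
      have len: "length ?xs = n + 2 * m" using n m_def by (simp add: length_concat_pairs)
      have "input_mem ?M"
        unfolding input_mem_def len
        using nth_concat_pairs[of _ es] n m_def by (auto simp: nth_append)
      moreover have "\<forall>a\<ge>aMark. ?M a = 0" by (simp only: len) (simp add: aMark_def)
      moreover have "init_state vs es = (?R, ?M)" using n m_def by (simp add: init_state_def Let_def)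
      ultimately show thesis using that by blast
    qed
    obtain t R' M' where ex: "exec solve_prog (?R, M) t (R', M')" and t: "t \<le> total_time"
      and out: "\<And>i. i < m \<Longrightarrow> M' (item i) = dp.page_of i"
      using wp_solve_prog[OF _ _ M, of ?R] unfolding wp_def by auto
    \<comment> \<open>The assignment is read from the final memory; each edge is listed exactly
      once, so the index is unique.\<close>
    define \<sigma> where "\<sigma> S = M' (THE j. j < m \<and> edge_of (es ! j) = S)" for S
    have \<sigma>: "\<sigma> (edge_of (es ! j)) = M' j" if "j < m" for j
    proof -
      have "(THE i. i < m \<and> edge_of (es ! i) = edge_of (es ! j)) = j"
        using that p(5) m_def by (intro the_equality) (auto simp: distinct_conv_nth)
      then show ?thesis by (simp add: \<sigma>_def)
    qed
    have crossE: "u < n \<and> v < n \<and> w < n \<and> x < n"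
      if "{u, v} \<in> E" "{w, x} \<in> E" for u v w x using that G V by (auto simp: fin_graph_def)
    have index: "\<exists>i<m. S = edge_of (es ! item i)" if "S \<in> E" for S
    proof -
      obtain j where j: "j < m" "S = edge_of (es ! j)" using \<open>S \<in> E\<close> p(4) m_def by (auto simp: in_set_conv_nth)
      then have "j \<in> item ` {..<m}" using bij_item by (simp add: bij_betw_def)
      then obtain i where "i < m" "item i = j" by auto
      then show ?thesis using j by auto
    qed
    have K: "dp.cost m 0 \<le> fobt V E r"
    \<comment> \<open>\<open>dp.cost_le\<close> speaks only of assignments with at most
      \<open>c\<close> pages; beyond that the bound \<open>cost_le_c\<close> is already
      enough.\<close>
    proof (cases "c \<le> fobt V E r")
      case True then show ?thesis using cost_le_c by simp
    next
      case False
      obtain \<sigma>0 where s0: "book_embedding (fobt V E r) V E r \<sigma>0" using fobt_attained[OF G r] by blast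
      let ?f = "\<lambda>t. \<sigma>0 (edge_of (es ! item t)) - 1"
      have pg: "\<sigma>0 (edge_of (es ! item t)) \<in> {1..fobt V E r}" if "t < m" for t
        using s0 inE[OF item_less[OF that]] by (auto simp: book_embedding_def)
      have "dp.noncrossing ?f"
        unfolding dp.noncrossing_def
      proof (intro allI impI notI)
        fix t a assume ta: "t < m" "a < t" "?f a = ?f t"
          and cr: "crosses (lft (item a)) (rgt (item a)) (lft (item t)) (rgt (item t))"
        have "a < m" using ta by simp
        \<comment> \<open>Pages are at least 1, so the shift by 1 to the numbering of the dynamic
          program merges none of them.\<close>
        have eq: "\<sigma>0 (edge_of (es ! item a)) = \<sigma>0 (edge_of (es ! item t))"
          using pg[OF ta(1)] pg[OF \<open>a < m\<close>] ta(3) by auto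
        note E = inE[OF item_less[OF ta(1)]] inE[OF item_less[OF \<open>a < m\<close>]]
        obtain u v w x where uv: "{u, v} = edge_of (es ! item a) \<and> {w, x} = edge_of (es ! item t) \<or>
          {u, v} = edge_of (es ! item t) \<and> {w, x} = edge_of (es ! item a)"
          "pos u < pos w" "pos w < pos v" "pos v < pos x"
          using cr crosses_edges_iff[OF item_less[OF \<open>a < m\<close>] item_less[OF ta(1)]] by blast
        then have in_E: "{u, v} \<in> E" "{w, x} \<in> E" "\<sigma>0 {u, v} = \<sigma>0 {w, x}" using E eq by metis+
        then have "(u, w) \<in> r" "(w, v) \<in> r" "(v, x) \<in> r" using crossE[OF in_E(1,2)] uv(2-4) rpos by auto
        then show False using s0 in_E unfolding book_embedding_def by blast
      qed
      moreover have "?f t < fobt V E r" if "t < m" for t using pg[OF that] by auto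
      ultimately show ?thesis using dp.cost_le[of ?f "fobt V E r" m] False by simp
    qed
    have "book_embedding (fobt V E r) V E r \<sigma>"
      unfolding book_embedding_def
    proof (intro conjI notI)
      show "\<sigma> \<in> E \<rightarrow> {1..fobt V E r}"
      proof
        fix S assume "S \<in> E"
        then obtain i where i: "i < m" "S = edge_of (es ! item i)" using index by blast
        then have "\<sigma> S = dp.page_of i" using \<sigma> out item_less by simp
        then show "\<sigma> S \<in> {1..fobt V E r}" using dp.page_of_noncrossing(2)[OF cost_le_c i(1)] K by simp
      qed
      assume "\<exists>u v w x. {u, v} \<in> E \<and> {w, x} \<in> E \<and> \<sigma> {u, v} = \<sigma> {w, x} \<and> (u, w) \<in> r \<and> (w, v) \<in> r \<and> (v, x) \<in> r"
      then obtain u v w x where uv: "{u, v} \<in> E" "{w, x} \<in> E" "\<sigma> {u, v} = \<sigma> {w, x}"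
        "pos u < pos w" "pos w < pos v" "pos v < pos x" using rpos by auto
      obtain a b where a: "a < m" "{u, v} = edge_of (es ! item a)" and b: "b < m" "{w, x} = edge_of (es ! item b)"
        using index uv(1,2) by metis
      have cr: "crosses (lft (item a)) (rgt (item a)) (lft (item b)) (rgt (item b))"
        unfolding crosses_edges_iff[OF item_less[OF a(1)] item_less[OF b(1)]] using a(2) b(2) uv(4-6) by blast
      have "dp.page_of a = dp.page_of b"
        using uv(3) a b \<sigma> out item_less by simp
      moreover have "a \<noteq> b" using cr by (auto simp: crosses_def)
      ultimately show False
        using dp.page_of_noncrossing(1)[OF cost_le_c] cr crosses_sym a(1) b(1)
        unfolding dp.noncrossing_def by (metis linorder_neqE_nat)
    qed (fact r)
    moreover have "outputs (R', M') es \<sigma>" using \<sigma> by (simp add: outputs_def m_def)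
    moreover have "real t \<le> 2 powr ?g ?\<tau> * real (max 1 n)"
    proof -
      have "10 + 4 * c + (2 * c + 1) * c * c \<le> 10 + 8 * ?\<tau> + (4 * ?\<tau> + 1) * (2 * ?\<tau>) * (2 * ?\<tau>)"
      proof -
        have "2 * c + 1 \<le> 4 * ?\<tau> + 1" using c\<tau> by simp
        then have "(2 * c + 1) * c * c \<le> (4 * ?\<tau> + 1) * (2 * ?\<tau>) * (2 * ?\<tau>)"
          using c\<tau> by (intro mult_le_mono)
        then show ?thesis using c\<tau> by linarith
      qed
      then have "t \<le> 2 ^ (10 + 8 * ?\<tau> + (4 * ?\<tau> + 1) * (2 * ?\<tau>) * (2 * ?\<tau>)) * max 1 n"
        using t total_time_le by (meson le_trans mult_le_mono1 one_le_numeral power_increasing)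
      then have "real t \<le> real (2 ^ (10 + 8 * ?\<tau> + (4 * ?\<tau> + 1) * (2 * ?\<tau>) * (2 * ?\<tau>)) * max 1 n)"
        by (rule of_nat_mono)
      then show ?thesis by (subst powr_realpow) auto
    qed
    ultimately show "\<exists>t s \<sigma>. exec solve_prog (init_state vs es) t s \<and>
        real t \<le> 2 powr ?g ?\<tau> * real (max 1 n) \<and> outputs s es \<sigma> \<and> book_embedding (fobt V E r) V E r \<sigma>"
      using ex init by metis
  qed
qed

end
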